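(* Let $n\ge3$ and let $L_1,\ldots,L_n$ be positive real numbers with $$L_k\le L_1+\cdots+\widehat{L_k}+\cdots+L_n\qquad\text{for all }k=1,\ldots,n,$$ where the hat means that the term $L_k$ is omitted. (i) If strict inequality holds in all of these inequalities, then there exists an oriented-convex cocyclic $n$-gon in the hyperbolic plane $\mathbb{B}$ with sidelengths $L_1,\ldots,L_n$. Such a polygon (oriented-convex and cocyclic with these sidelengths) is uniquely determined up to hyperbolic equivalence. (ii) If equality holds in one of these inequalities, say $L_n=L_1+\cdots+L_{n-1}$, then there also exists an $n$-gon in $\mathbb{B}$ with sidelengths $L_1,\ldots,L_n$. Such a polygon is uniquely determined up to hyperbolic congruence, it is collinear, and its vertices $Z_1,\ldots,Z_n$ are in this order strictly monotonically arranged on the supporting line; in particular they are pairwise distinct.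
   Context: Model: the hyperbolic plane is $\mathbb{B}=\{(\xi_1,\xi_2)\in\mathbb{R}^2 : \xi_1^2+\xi_2^2<1\}$ (Cayley/Klein model), oriented as a subset of $\mathbb{R}^2$; its straight lines are the open straight chords. On $\mathbb{R}^3$ put $\langle x,y\rangle=x_0y_0-x_1y_1-x_2y_2$ and $\|x\|=\sqrt{|\langle x,x\rangle|}$; $[x,y,z]$ is the standard determinant. A point $X=(\xi_1,\xi_2)\in\mathbb{B}$ is represented by point vectors $x=(x_0,x_1,x_2)$ with $x_0>0$, $\xi_i=x_i/x_0$ (so $\langle x,x\rangle>0$). The hyperbolic distance $d$ is given by $\cosh d(X,Y)=\langle x,y\rangle/(\|x\|\,\|y\|)$. Equivalence and congruence: a hyperbolic isometry is an isometry of $(\mathbb{B},d)$ onto itself; a hyperbolic motion is an orientation-preserving hyperbolic isometry. Two polygons are hyperbolically equivalent (resp. congruent) if a hyperbolic motion (resp. a hyperbolic isometry) carries one to the other, corresponding vertices to corresponding vertices. Polygons: an $n$-gon ($n\ge3$) $Z_1\ldots Z_n$ is a list of points $Z_1,\ldots,Z_n\in\mathbb{B}$ (vertices) with $Z_k\neq Z_{k+1}$ for all $k$, indices modulo $n$; lists differing by a cyclic permutation define the same polygon. Its sidelengths are $L_k=d(Z_k,Z_{k+1})$, $k=1,\ldots,n$ (so $L_n=d(Z_n,Z_1)$). The polygon is oriented-convex if $[z_k,z_{k+1},z_j]>0$ for all $k\in\{1,\ldots,n\}$ and all $j\in\{1,\ldots,n\}$ different from $k,k+1$ (mod $n$). It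 is collinear if its vertices lie on a straight line and cocyclic if they lie on a circle. Circles: a circle in $\mathbb{B}$ is the set of points whose normalized point vectors $x$ ($\langle x,x\rangle=1$, $x_0>0$) satisfy $\langle u,x\rangle=p$ for fixed $0\ne u\in\mathbb{R}^3$, $p\neq0$, of one of three types: distance circle ($\langle u,u\rangle>0$, $u_0>0$, $p>\|u\|$; equivalently the set of points at a fixed distance $R>0$ from a center $C\in\mathbb{B}$); distance line ($\langle u,u\rangle<0$; equivalently the set of points at a fixed distance $\delta>0$ from a straight line on one side of it); horocycle ($\langle u,u\rangle=0$, $u_0>0$, $p>0$). *)

theory Defs
  imports "HOL-Analysis.Analysis"
begin

text \<open>The coordinates \<open>x\<^sub>0, x\<^sub>1, x\<^sub>2\<close> of a vector of \<open>\<real>\<^sup>3\<close> are \<open>x $ 1, x $ 2, x $ 3\<close>.\<close>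

definition lform :: "real^3 \<Rightarrow> real^3 \<Rightarrow> real" where
  "lform x y = x $ 1 * y $ 1 - x $ 2 * y $ 2 - x $ 3 * y $ 3"

definition lnorm :: "real^3 \<Rightarrow> real" where
  "lnorm x = sqrt \<bar>lform x x\<bar>"

definition det3 :: "real^3 \<Rightarrow> real^3 \<Rightarrow> real^3 \<Rightarrow> real" where
  "det3 x y z = det (vector [x, y, z] :: real^3^3)"

definition hyp_plane :: "(real^2) set" where
  "hyp_plane = {X. (X $ 1)\<^sup>2 + (X $ 2)\<^sup>2 < 1}"

definition is_point_vector :: "real^3 \<Rightarrow> real^2 \<Rightarrow> bool" where
  "is_point_vector x X \<longleftrightarrow> x $ 1 > 0 \<and> X $ 1 = x $ 2 / x $ 1 \<and> X $ 2 = x $ 3 / x $ 1"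

text \<open>The representative with \<open>x\<^sub>0 = 1\<close>. The notions below are defined with it; the lemmas
  named \<open>is_point_vector_\<dots>\<close> show that any other point vectors may be used instead.\<close>

definition point_vec :: "real^2 \<Rightarrow> real^3" where
  "point_vec X = vector [1, X $ 1, X $ 2]"

definition npoint_vec :: "real^2 \<Rightarrow> real^3" where
  "npoint_vec X = (1 / lnorm (point_vec X)) *\<^sub>R point_vec X"

definition hyp_dist :: "real^2 \<Rightarrow> real^2 \<Rightarrow> real" where
  "hyp_dist X Y =
     arcosh (lform (point_vec X) (point_vec Y) / (lnorm (point_vec X) * lnorm (point_vec Y)))"

definition hyp_isometry :: "(real^2 \<Rightarrow> real^2) \<Rightarrow> bool" where
  "hyp_isometry f \<longleftrightarrow> f ` hyp_plane = hyp_plane \<and>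
     (\<forall>X\<in>hyp_plane. \<forall>Y\<in>hyp_plane. hyp_dist (f X) (f Y) = hyp_dist X Y)"

text \<open>Orientation is that of the open subset \<^term>\<open>hyp_plane\<close> of the plane, so a map
  preserves it if its Jacobian determinant is positive. Requiring differentiability is no
  restriction: isometries are projective maps in this model.\<close>

definition hyp_motion :: "(real^2 \<Rightarrow> real^2) \<Rightarrow> bool" where
  "hyp_motion f \<longleftrightarrow> hyp_isometry f \<and>
     (\<forall>X\<in>hyp_plane. f differentiable (at X) \<and> det (jacobian f (at X)) > 0)"

definition hyp_line :: "(real^2) set \<Rightarrow> bool" where
  "hyp_line l \<longleftrightarrow>
     (\<exists>P Q. P \<noteq> Q \<and> norm P = 1 \<and> norm Q = 1 \<and> l = open_segment P Q)"

text \<open>The three disjuncts are distance circles, distance lines and horocycles.\<close>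

definition hyp_circle :: "(real^2) set \<Rightarrow> bool" where
  "hyp_circle C \<longleftrightarrow>
     (\<exists>u p. u \<noteq> 0 \<and> p \<noteq> 0 \<and>
        (lform u u > 0 \<and> u $ 1 > 0 \<and> p > lnorm u \<or>
         lform u u < 0 \<or>
         lform u u = 0 \<and> u $ 1 > 0 \<and> p > 0) \<and>
        C = {X \<in> hyp_plane. lform u (npoint_vec X) = p})"

text \<open>A polygon is given by its list of vertices, numbered from 0, with a chosen first vertex:
  the vertex \<open>Z\<^sub>k\<^sub>+\<^sub>1\<close> is \<open>Z ! k\<close>. Lists that differ by a rotation are the same polygon; all
  notions for polygons respect this (rotating the sidelengths along with the vertices), except
  for the monotone arrangement along a line, where the first vertex matters.\<close>

definition ngon :: "nat \<Rightarrow> (real^2) list \<Rightarrow> bool" where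
  "ngon n Z \<longleftrightarrow> n \<ge> 3 \<and> length Z = n \<and> set Z \<subseteq> hyp_plane \<and>
     (\<forall>k<n. Z ! k \<noteq> Z ! (Suc k mod n))"

definition sidelengths :: "(real^2) list \<Rightarrow> real list" where
  "sidelengths Z = map (\<lambda>k. hyp_dist (Z ! k) (Z ! (Suc k mod length Z))) [0..<length Z]"

definition oriented_convex :: "(real^2) list \<Rightarrow> bool" where
  "oriented_convex Z \<longleftrightarrow>
     (\<forall>k<length Z. \<forall>j<length Z. j \<noteq> k \<and> j \<noteq> Suc k mod length Z \<longrightarrow>
        det3 (point_vec (Z ! k)) (point_vec (Z ! (Suc k mod length Z))) (point_vec (Z ! j)) > 0)"

definition collinear_polygon :: "(real^2) list \<Rightarrow> bool" where
  "collinear_polygon Z \<longleftrightarrow> (\<exists>l. hyp_line l \<and> set Z \<subseteq> l)"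

definition cocyclic_polygon :: "(real^2) list \<Rightarrow> bool" where
  "cocyclic_polygon Z \<longleftrightarrow> (\<exists>C. hyp_circle C \<and> set Z \<subseteq> C)"

text \<open>The endpoints \<open>P\<close> and \<open>Q\<close> may be interchanged, so either direction along the line is
  allowed.\<close>

definition strictly_monotone_along :: "(real^2) set \<Rightarrow> (real^2) list \<Rightarrow> bool" where
  "strictly_monotone_along l Z \<longleftrightarrow>
     (\<exists>P Q ts. P \<noteq> Q \<and> norm P = 1 \<and> norm Q = 1 \<and> l = open_segment P Q \<and>
        sorted_wrt (<) ts \<and> set ts \<subseteq> {0<..<1} \<and>
        Z = map (\<lambda>t. (1 - t) *\<^sub>R P + t *\<^sub>R Q) ts)"

definition hyp_equivalent :: "(real^2) list \<Rightarrow> (real^2) list \<Rightarrow> bool" where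
  "hyp_equivalent Z W \<longleftrightarrow> (\<exists>f. hyp_motion f \<and> map f Z = W)"

definition hyp_congruent :: "(real^2) list \<Rightarrow> (real^2) list \<Rightarrow> bool" where
  "hyp_congruent Z W \<longleftrightarrow> (\<exists>f. hyp_isometry f \<and> map f Z = W)"

lemma point_vec_nth [simp]:
  "point_vec X $ 1 = 1" "point_vec X $ 2 = X $ 1" "point_vec X $ 3 = X $ 2"
  by (simp_all add: point_vec_def vector_3)

lemma is_point_vector_iff: "is_point_vector x X \<longleftrightarrow> (\<exists>c>0. x = c *\<^sub>R point_vec X)"
proof
  assume "is_point_vector x X"
  then have "x $ 1 > 0" "x = (x $ 1) *\<^sub>R point_vec X"
    by (auto simp: is_point_vector_def vec_eq_iff forall_3)
  then show "\<exists>c>0. x = c *\<^sub>R point_vec X" by blast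
qed (auto simp: is_point_vector_def)

lemma lform_scaleR: "lform (a *\<^sub>R x) (b *\<^sub>R y) = a * b * lform x y"
  by (simp add: lform_def algebra_simps)

lemma lnorm_scaleR: "lnorm (a *\<^sub>R x) = \<bar>a\<bar> * lnorm x"
  by (simp add: lnorm_def lform_scaleR abs_mult real_sqrt_mult)

lemma is_point_vector_hyp_dist:
  assumes "is_point_vector x X" "is_point_vector y Y"
  shows "hyp_dist X Y = arcosh (lform x y / (lnorm x * lnorm y))"
proof -
  obtain a b where "a > 0" "x = a *\<^sub>R point_vec X" "b > 0" "y = b *\<^sub>R point_vec Y"
    using assms unfolding is_point_vector_iff by blast
  then show ?thesis by (simp add: hyp_dist_def lform_scaleR lnorm_scaleR)
qed

lemma is_point_vector_det3:
  assumes "is_point_vector x X" "is_point_vector y Y" "is_point_vector z Z"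
  shows "det3 x y z > 0 \<longleftrightarrow> det3 (point_vec X) (point_vec Y) (point_vec Z) > 0"
proof -
  obtain a b c where abc: "a > 0" "x = a *\<^sub>R point_vec X" "b > 0" "y = b *\<^sub>R point_vec Y"
      "c > 0" "z = c *\<^sub>R point_vec Z"
    using assms unfolding is_point_vector_iff by blast
  have "det3 x y z = a * b * c * det3 (point_vec X) (point_vec Y) (point_vec Z)"
    by (simp add: abc det3_def det_3 vector_3 algebra_simps)
  moreover have "a * b * c > 0" using abc by simp
  ultimately show ?thesis by (simp only: zero_less_mult_iff[of "a * b * c"]) (meson less_asym)
qed

lemma is_point_vector_normalized:
  assumes "X \<in> hyp_plane"
  shows "is_point_vector x X \<and> lform x x = 1 \<longleftrightarrow> x = npoint_vec X"
proof -
  let ?q = "lform (point_vec X) (point_vec X)"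
  have q: "?q > 0" using assms by (simp add: lform_def hyp_plane_def power2_eq_square)
  then have l: "lnorm (point_vec X) = sqrt ?q" by (simp add: lnorm_def)
  show ?thesis
  proof
    assume "is_point_vector x X \<and> lform x x = 1"
    then obtain c where c: "c > 0" "x = c *\<^sub>R point_vec X" "lform x x = 1"
      unfolding is_point_vector_iff by blast
    then have "c\<^sup>2 * ?q = 1" by (simp add: lform_scaleR power2_eq_square)
    then have "sqrt (c\<^sup>2 * ?q) = 1" by simp
    then have "c * sqrt ?q = 1" using c(1) by (simp add: real_sqrt_mult)
    then have "c = 1 / sqrt ?q" using q by (simp add: field_simps)
    then show "x = npoint_vec X" using c l by (simp add: npoint_vec_def)
  next
    assume x: "x = npoint_vec X"
    have "is_point_vector x X"
      unfolding is_point_vector_iff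
      by (rule exI[of _ "1 / sqrt ?q"]) (use q l x in \<open>simp add: npoint_vec_def\<close>)
    moreover have "lform x x = 1"
      using q by (simp add: x npoint_vec_def lform_scaleR l)
    ultimately show "is_point_vector x X \<and> lform x x = 1" by blast
  qed
qed

end

theory Submission
  imports Defs
begin

text \<open>
  A vertex is represented by its normalized point vector, a point of the hyperboloid
  \<open>\<langle>x, x\<rangle> = 1\<close>, \<open>x\<^sub>0 > 0\<close>. There \<open>\<langle>x, y\<rangle> = 1 + 2 sinh\<^sup>2 (d/2)\<close>, so a side of
  length \<open>L\<close> enters only through \<open>s = sinh (L/2)\<close>.

  The three types of circles are treated together. After an isometry that carries a point of
  the circle to \<open>(1, 0, 0)\<close>, the circle is the section of the hyperboloid by the plane
  \<open>sqrt (1 + k) (x\<^sub>0 - 1) = x\<^sub>2\<close> for some \<open>k > -1\<close>; it is a distance circle, a horocycle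
  or a distance line according to whether \<open>k\<close> is positive, zero or negative. With the generalized
  sine and cosine, \<open>c\<^sup>2 + k s\<^sup>2 = 1\<close>, this section is parametrized by
  \<open>(1 + 2 s\<^sup>2, 2 s c, 2 sqrt (1 + k) s\<^sup>2)\<close>. Two identities carry the geometry: the
  chord between the parameters \<open>a\<close> and \<open>b\<close> has \<open>sinh (d/2) = |sn (a - b)|\<close>
  (\<open>lform_circle_point\<close>), and the determinant of three points is a positive multiple of
  \<open>sn (b - a) sn (c - b) sn (c - a)\<close> (\<open>det3_circle_point\<close>), so that convexity is a statement about the
  order of the parameters. Number the vertices such that the longest side is the last one, and let
  \<open>s\<^sub>0, \<dots>, s\<^sub>N\<close> be the values of \<open>sinh (L/2)\<close> for the sides. Then convex polygons on the circle
  correspond to increasing sequences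
  \<open>0 = \<alpha>\<^sub>0 < \<dots> < \<alpha>\<^sub>N\<close>, below one turn \<open>pi / sqrt k\<close> of the circle if \<open>k > 0\<close>, with
  \<open>sn (\<alpha>\<^sub>i\<^sub>+\<^sub>1 - \<alpha>\<^sub>i) = s\<^sub>i\<close> for \<open>i < N\<close> and \<open>sn \<alpha>\<^sub>N = s\<^sub>N\<close>
  (\<open>circle_polygon_properties\<close>, \<open>convex_cocyclic_normal_form\<close>).

  It remains to solve for \<open>k\<close>. For \<open>k = -1\<close>, where the circle degenerates to a line, the arc
  over a side is half its length, and the strict polygon inequality says that the short arcs
  together exceed the longest one. An intermediate value argument
  between \<open>k = -1\<close> and the circle having the longest side as
  diameter gives either a circle whose arcs over the short sides add up to the small arc over the
  longest side, or one for which they add up to the complementary arc (\<open>inscribed_exists\<close>). The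
  solution is unique because, for \<open>k < k'\<close>, the map sending the arc over a chord for \<open>k'\<close>
  to the arc over the same chord for \<open>k\<close> is strictly subadditive (\<open>inscribed_unique\<close>).
  Two polygons with the same sides are therefore images of one polygon under two motions, hence
  equivalent.

  In the case of equality the triangle inequality, which expresses that the Gram determinant
  of three vectors is a square, is an equality throughout. It determines all distances between
  vertices, and these force every vertex to be \<open>cosh t e\<^sub>0 + sinh t e\<^sub>1\<close> in an
  orthonormal frame adapted to the first and the last vertex
  (\<open>degenerate_normal_form\<close>).
\<close>


section \<open>Normalized point vectors\<close>

definition hyperboloid :: "(real^3) set" where
  "hyperboloid = {x. lform x x = 1 \<and> x $ 1 > 0}"

definition proj :: "real^3 \<Rightarrow> real^2" where
  "proj x = vector [x $ 2 / x $ 1, x $ 3 / x $ 1]"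

lemma proj_nth [simp]: "proj x $ 1 = x $ 2 / x $ 1" "proj x $ 2 = x $ 3 / x $ 1"
  by (simp_all add: proj_def)

lemma is_point_vector_proj: "x $ 1 > 0 \<Longrightarrow> is_point_vector x (proj x)"
  by (simp add: is_point_vector_def)

lemma proj_unique: "is_point_vector x X \<Longrightarrow> proj x = X"
  by (simp add: is_point_vector_def vec_eq_iff forall_2)

lemma npoint_vec_hyperboloid:
  assumes "X \<in> hyp_plane"
  shows "npoint_vec X \<in> hyperboloid" "proj (npoint_vec X) = X"
  using is_point_vector_normalized[OF assms, of "npoint_vec X"]
  by (auto simp: hyperboloid_def is_point_vector_def proj_unique)

lemma proj_hyperboloid:
  assumes "x \<in> hyperboloid"
  shows "proj x \<in> hyp_plane" "npoint_vec (proj x) = x"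
proof -
  have x: "x $ 1 > 0" "x $ 1 * x $ 1 - x $ 2 * x $ 2 - x $ 3 * x $ 3 = 1"
    using assms by (auto simp: hyperboloid_def lform_def)
  have "(x $ 2)\<^sup>2 + (x $ 3)\<^sup>2 < (x $ 1)\<^sup>2" using x(2) unfolding power2_eq_square by linarith
  then show p: "proj x \<in> hyp_plane"
    using x(1) by (simp add: hyp_plane_def power_divide divide_simps flip: add_divide_distrib)
  show "npoint_vec (proj x) = x"
    using is_point_vector_normalized[OF p, of x] is_point_vector_proj[OF x(1)] assms
    by (simp add: hyperboloid_def)
qed

lemma hyp_dist_proj:
  assumes "x \<in> hyperboloid" "y \<in> hyperboloid"
  shows "hyp_dist (proj x) (proj y) = arcosh (lform x y)"
  using is_point_vector_hyp_dist[OF is_point_vector_proj is_point_vector_proj, of x y] assms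
  by (simp add: hyperboloid_def lnorm_def)

lemma det3_proj_pos_iff:
  assumes "x \<in> hyperboloid" "y \<in> hyperboloid" "z \<in> hyperboloid"
  shows "det3 (point_vec (proj x)) (point_vec (proj y)) (point_vec (proj z)) > 0
    \<longleftrightarrow> det3 x y z > 0"
  using is_point_vector_det3[OF is_point_vector_proj is_point_vector_proj is_point_vector_proj,
    of x y z] assms by (simp add: hyperboloid_def)

lemma lform_commute: "lform x y = lform y x"
  by (simp add: lform_def)

lemma lform_add_left: "lform (x + y) z = lform x z + lform y z"
  and lform_add_right: "lform z (x + y) = lform z x + lform z y"
  and lform_diff_left: "lform (x - y) z = lform x z - lform y z"
  and lform_diff_right: "lform z (x - y) = lform z x - lform z y"
  and lform_scaleR_left: "lform (a *\<^sub>R x) z = a * lform x z"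
  and lform_scaleR_right: "lform z (a *\<^sub>R x) = a * lform z x"
  by (simp_all add: lform_def algebra_simps)

lemmas lform_bilinear = lform_add_left lform_add_right lform_diff_left lform_diff_right
  lform_scaleR_left lform_scaleR_right

lemma det3_expand: "det3 x y z =
    x $ 1 * y $ 2 * z $ 3 + x $ 2 * y $ 3 * z $ 1 + x $ 3 * y $ 1 * z $ 2
    - x $ 1 * y $ 3 * z $ 2 - x $ 2 * y $ 1 * z $ 3 - x $ 3 * y $ 2 * z $ 1"
  by (simp add: det3_def det_3 vector_3)

text \<open>The right side is the Gram determinant: the matrix of the form, \<open>diag (1, -1, -1)\<close>, has
  determinant \<open>1\<close>. That the left side is a square yields the triangle inequality.\<close>

lemma gram_det3:
  "(det3 x y z)\<^sup>2 =
    lform x x * lform y y * lform z z + 2 * lform x y * lform y z * lform x z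
    - lform x x * (lform y z)\<^sup>2 - lform y y * (lform x z)\<^sup>2 - lform z z * (lform x y)\<^sup>2"
  unfolding det3_expand lform_def by algebra

text \<open>Reversed Cauchy--Schwarz inequality, from a Lagrange identity that exhibits the defect as
  a sum of three squares.\<close>

lemma lform_hyperboloid_ge_1:
  assumes "x \<in> hyperboloid" "y \<in> hyperboloid"
  shows "lform x y \<ge> 1"
proof -
  define a b c d e f where "a = x $ 1" "b = x $ 2" "c = x $ 3" "d = y $ 1" "e = y $ 2" "f = y $ 3"
  note defs = this
  have x: "a > 0" "a\<^sup>2 = 1 + b\<^sup>2 + c\<^sup>2" and y: "d > 0" "d\<^sup>2 = 1 + e\<^sup>2 + f\<^sup>2"
    using assms by (auto simp: hyperboloid_def lform_def defs power2_eq_square)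
  have "(a * d)\<^sup>2 = (1 + b * e + c * f)\<^sup>2 + (b - e)\<^sup>2 + (c - f)\<^sup>2 + (b * f - c * e)\<^sup>2"
    unfolding power_mult_distrib x(2) y(2) by algebra
  then have "(1 + b * e + c * f)\<^sup>2 \<le> (a * d)\<^sup>2" by (smt (verit) zero_le_power2)
  then have "1 + b * e + c * f \<le> a * d"
    using x(1) y(1) by (meson mult_pos_pos less_imp_le power2_le_imp_le)
  then show ?thesis by (simp add: lform_def defs)
qed

lemma lform_hyperboloid_eq_1_iff:
  assumes "x \<in> hyperboloid" "y \<in> hyperboloid"
  shows "lform x y = 1 \<longleftrightarrow> x = y"
proof
  define a b c d e f where "a = x $ 1" "b = x $ 2" "c = x $ 3" "d = y $ 1" "e = y $ 2" "f = y $ 3"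
  note defs = this
  have x: "a > 0" "a\<^sup>2 = 1 + b\<^sup>2 + c\<^sup>2" and y: "d > 0" "d\<^sup>2 = 1 + e\<^sup>2 + f\<^sup>2"
    using assms by (auto simp: hyperboloid_def lform_def defs power2_eq_square)
  assume "lform x y = 1"
  then have ad: "a * d = 1 + b * e + c * f" by (simp add: lform_def defs)
  have "(a * d)\<^sup>2 = (1 + b * e + c * f)\<^sup>2 + (b - e)\<^sup>2 + (c - f)\<^sup>2 + (b * f - c * e)\<^sup>2"
    unfolding power_mult_distrib x(2) y(2) by algebra
  then have "(b - e)\<^sup>2 + (c - f)\<^sup>2 + (b * f - c * e)\<^sup>2 = 0" unfolding ad by simp
  then have be: "b = e" "c = f"
    by (smt (verit) zero_le_power2 zero_eq_power2 eq_iff_diff_eq_0)+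
  then have "a\<^sup>2 = d\<^sup>2" using x y by simp
  then have "a = d" using x(1) y(1) by (simp add: power2_eq_iff_nonneg)
  with be show "x = y" by (simp add: vec_eq_iff forall_3 defs)
next
  assume "x = y" then show "lform x y = 1" using assms by (simp add: hyperboloid_def)
qed

lemma cosh_hyp_dist_proj:
  assumes "x \<in> hyperboloid" "y \<in> hyperboloid"
  shows "cosh (hyp_dist (proj x) (proj y)) = lform x y" "hyp_dist (proj x) (proj y) \<ge> 0"
  using lform_hyperboloid_ge_1[OF assms] by (simp_all add: hyp_dist_proj[OF assms])

lemma lform_eq_sinh_half:
  assumes "x \<in> hyperboloid" "y \<in> hyperboloid"
  shows "lform x y = 1 + 2 * (sinh (hyp_dist (proj x) (proj y) / 2))\<^sup>2"
  unfolding cosh_hyp_dist_proj(1)[OF assms, symmetric]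
  using cosh_double[of "hyp_dist (proj x) (proj y) / 2"] cosh_square_eq[of "hyp_dist (proj x) (proj y) / 2"] by simp

lemma hyp_dist_eq_iff_lform:
  assumes "x \<in> hyperboloid" "y \<in> hyperboloid" "t \<ge> 0"
  shows "hyp_dist (proj x) (proj y) = t \<longleftrightarrow> lform x y = cosh t"
  using assms(3) cosh_hyp_dist_proj[OF assms(1,2)] by (metis hyp_dist_proj[OF assms(1,2)] arcosh_cosh_real)

section \<open>Lorentz matrices as isometries and motions\<close>

text \<open>The second condition rules out isometries of the form that exchange the two sheets of
  \<open>\<langle>x, x\<rangle> = 1\<close>.\<close>

definition lorentz :: "real^3^3 \<Rightarrow> bool" where
  "lorentz A \<longleftrightarrow> (\<forall>x y. lform (A *v x) (A *v y) = lform x y) \<and>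
     (\<forall>x\<in>hyperboloid. A *v x \<in> hyperboloid)"

lemma lorentz_lform: "lorentz A \<Longrightarrow> lform (A *v x) (A *v y) = lform x y"
  and lorentz_hyperboloid: "lorentz A \<Longrightarrow> x \<in> hyperboloid \<Longrightarrow> A *v x \<in> hyperboloid"
  by (simp_all add: lorentz_def)

definition cols3 :: "real^3 \<Rightarrow> real^3 \<Rightarrow> real^3 \<Rightarrow> real^3^3" where
  "cols3 a b c = transpose (vector [a, b, c])"

lemma cols3_mult: "cols3 a b c *v x = x $ 1 *\<^sub>R a + x $ 2 *\<^sub>R b + x $ 3 *\<^sub>R c"
  by (simp add: cols3_def vec_eq_iff matrix_vector_mult_def transpose_def sum_3 vector_3 algebra_simps)

lemma det_cols3: "det (cols3 a b c) = det3 a b c"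
  by (simp add: cols3_def det3_def)

text \<open>The map preserves the sheet \<open>x\<^sub>0 > 0\<close> because the image of \<open>x\<close> has the product
  \<open>x\<^sub>0\<close> with the future-pointing vector \<open>a\<close>.\<close>

lemma lorentz_cols3:
  assumes "a \<in> hyperboloid" "lform b b = - 1" "lform c c = - 1"
    "lform a b = 0" "lform a c = 0" "lform b c = 0"
  shows "lorentz (cols3 a b c)"
proof -
  let ?A = "cols3 a b c"
  have a1: "lform a a = 1" using assms(1) by (simp add: hyperboloid_def)
  have ba: "lform b a = 0" "lform c a = 0" "lform c b = 0" using assms by (simp_all add: lform_commute)
  have L: "lform (?A *v x) (?A *v y) = lform x y" for x y
    using assms a1 ba by (simp add: cols3_mult lform_bilinear) (simp add: lform_def)
  have "?A *v x \<in> hyperboloid" if x: "x \<in> hyperboloid" for x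
  proof -
    define y where "y = ?A *v x"
    have y1: "lform y y = 1" using L x by (simp add: y_def hyperboloid_def)
    have "lform y a = x $ 1" unfolding y_def cols3_mult
      using a1 ba by (simp add: lform_bilinear)
    then have p: "lform y a > 0" using x by (simp add: hyperboloid_def)
    show ?thesis unfolding y_def[symmetric]
    \<comment> \<open>Otherwise \<open>- y\<close> would lie on the hyperboloid and have a negative product with \<open>a\<close>.\<close>
    proof (cases "y $ 1 > 0")
      case False
      have "y $ 1 \<noteq> 0" using y1 by (auto simp: lform_def) (smt (verit) zero_le_square)
      then have "(-1) *\<^sub>R y \<in> hyperboloid" using False y1
        by (simp add: hyperboloid_def lform_def)
      from lform_hyperboloid_ge_1[OF this assms(1)] p show "y \<in> hyperboloid"
        by (simp only: lform_scaleR_left)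
    qed (use y1 in \<open>simp add: hyperboloid_def\<close>)
  qed
  with L show ?thesis by (simp add: lorentz_def)
qed

lemma lorentz_mult: "lorentz A \<Longrightarrow> lorentz B \<Longrightarrow> lorentz (A ** B)"
  by (simp add: lorentz_def flip: matrix_vector_mul_assoc)

lemma lorentz_inverse:
  assumes "lorentz A"
  obtains B where "lorentz B" "B ** A = mat 1" "A ** B = mat 1"
proof -
  have "inj ((*v) A)"
  proof (rule injI)
    fix x y assume "A *v x = A *v y"
    then have "lform x z = lform y z" for z using lorentz_lform[OF assms] by metis
    from this[of "axis 1 1"] this[of "axis 2 1"] this[of "axis 3 1"] show "x = y"
      by (simp add: lform_def axis_def vec_eq_iff forall_3)
  qed
  then have "invertible A" by (simp add: invertible_left_inverse matrix_left_invertible_injective)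
  then obtain B where B: "A ** B = mat 1" "B ** A = mat 1" by (auto simp: invertible_def)
  have AB: "A *v (B *v x) = x" for x by (simp add: matrix_vector_mul_assoc B)
  have L: "lform (B *v x) (B *v y) = lform x y" for x y
    using lorentz_lform[OF assms, of "B *v x" "B *v y"] by (simp add: AB)
  have "B *v x \<in> hyperboloid" if x: "x \<in> hyperboloid" for x
  proof (rule ccontr)
    define y where "y = B *v x"
    assume "B *v x \<notin> hyperboloid"
    moreover have "lform y y = 1" using L x by (simp add: y_def hyperboloid_def)
    moreover from this have "y $ 1 \<noteq> 0" by (auto simp: lform_def) (smt (verit) zero_le_square)
    ultimately have "(-1) *\<^sub>R y \<in> hyperboloid"
      by (simp add: hyperboloid_def lform_def y_def)
    from lorentz_hyperboloid[OF assms this] have "- x \<in> hyperboloid"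
      by (simp add: y_def AB vec.neg matrix_vector_mult_scaleR)
    then show False using x by (simp add: hyperboloid_def)
  qed
  with L have "lorentz B" by (simp add: lorentz_def)
  with B that show ?thesis by blast
qed

definition lorentz_map :: "real^3^3 \<Rightarrow> real^2 \<Rightarrow> real^2" where
  "lorentz_map A X = proj (A *v point_vec X)"

lemma proj_scaleR: "c \<noteq> 0 \<Longrightarrow> proj (c *\<^sub>R x) = proj x"
  by (simp add: vec_eq_iff forall_2)

lemma lnorm_point_vec_pos: "X \<in> hyp_plane \<Longrightarrow> lnorm (point_vec X) > 0"
  by (simp add: lnorm_def lform_def hyp_plane_def power2_eq_square)

lemma lorentz_map_eq:
  assumes "X \<in> hyp_plane"
  shows "lorentz_map A X = proj (A *v npoint_vec X)"
  using lnorm_point_vec_pos[OF assms]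
  by (simp add: lorentz_map_def npoint_vec_def matrix_vector_mult_scaleR proj_scaleR)

lemma lorentz_map_proj: "x \<in> hyperboloid \<Longrightarrow> lorentz_map A (proj x) = proj (A *v x)"
  by (simp add: lorentz_map_eq proj_hyperboloid)

lemma hyp_plane_eq_proj: "hyp_plane = proj ` hyperboloid"
  using npoint_vec_hyperboloid proj_hyperboloid by (force simp: image_iff)

lemma hyp_isometry_lorentz_map:
  assumes A: "lorentz A"
  shows "hyp_isometry (lorentz_map A)"
proof -
  obtain B where B: "lorentz B" "B ** A = mat 1" "A ** B = mat 1" using lorentz_inverse[OF A] by blast
  have im: "(*v) A ` hyperboloid = hyperboloid"
  proof
    show "hyperboloid \<subseteq> (*v) A ` hyperboloid"
    proof
      fix x assume "x \<in> hyperboloid"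
      then have "B *v x \<in> hyperboloid" using lorentz_hyperboloid B by blast
      moreover have "x = A *v (B *v x)" by (simp add: matrix_vector_mul_assoc B)
      ultimately show "x \<in> (*v) A ` hyperboloid" by blast
    qed
  qed (use lorentz_hyperboloid[OF A] in auto)
  have "lorentz_map A ` hyp_plane = proj ` (*v) A ` hyperboloid"
    unfolding hyp_plane_eq_proj image_image by (rule image_cong) (simp_all add: lorentz_map_proj)
  then show ?thesis unfolding hyp_isometry_def im
    by (auto simp: hyp_plane_eq_proj lorentz_map_proj hyp_dist_proj lorentz_hyperboloid[OF A] lorentz_lform[OF A])
qed

text \<open>Positivity of \<open>det A\<close> is preservation of orientation: the denominator of the projective
  map is positive on the disc.\<close>

lemma hyp_motion_lorentz_map:
  assumes A: "lorentz A" and d: "det A > 0"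
  shows "hyp_motion (lorentz_map A)"
proof -
  have "lorentz_map A differentiable (at X) \<and> det (jacobian (lorentz_map A) (at X)) > 0" if X: "X \<in> hyp_plane" for X
  proof -
    define y where "y i X = A $ i $ 1 + A $ i $ 2 * X $ 1 + A $ i $ 3 * X $ 2" for i and X :: "real^2"
    have yA: "(A *v point_vec X) $ i = y i X" for X i
      by (simp add: y_def matrix_vector_mult_def sum_3)
    have "(A *v npoint_vec X) $ 1 > 0"
      using lorentz_hyperboloid[OF A npoint_vec_hyperboloid(1)[OF X]] by (simp add: hyperboloid_def)
    then have y0: "y 1 X > 0" using lnorm_point_vec_pos[OF X]
      by (simp add: npoint_vec_def matrix_vector_mult_scaleR yA zero_less_divide_iff)
    define D where "D = (\<lambda>h::real^2. vector
       [((A$2$2 * h$1 + A$2$3 * h$2) * y 1 X - y 2 X * (A$1$2 * h$1 + A$1$3 * h$2)) / (y 1 X)\<^sup>2,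
        ((A$3$2 * h$1 + A$3$3 * h$2) * y 1 X - y 3 X * (A$1$2 * h$1 + A$1$3 * h$2)) / (y 1 X)\<^sup>2] :: real^2)"
    have dy: "(y i has_derivative (\<lambda>h. A$i$2 * h$1 + A$i$3 * h$2)) (at X)" for i
      unfolding y_def by (auto intro!: derivative_eq_intros bounded_linear.has_derivative[OF bounded_linear_vec_nth])
    have hf: "lorentz_map A = (\<lambda>X. vector [y 2 X / y 1 X, y 3 X / y 1 X])"
      by (auto simp: lorentz_map_def proj_def yA)
    have q: "((\<lambda>X. y i X / y 1 X) has_derivative
        (\<lambda>h. ((A$i$2 * h$1 + A$i$3 * h$2) * y 1 X - y i X * (A$1$2 * h$1 + A$1$3 * h$2)) / (y 1 X)\<^sup>2)) (at X)" for i
      using has_derivative_divide'[OF dy[of i] dy[of 1]] y0 by (simp add: power2_eq_square)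
    have "(lorentz_map A has_derivative D) (at X)"
      unfolding hf D_def using q[of 2] q[of 3]
      by (subst has_derivative_componentwise_within) (auto simp: Basis_vec_def inner_axis forall_2 exhaust_2)
    then have fd: "frechet_derivative (lorentz_map A) (at X) = D" and df: "lorentz_map A differentiable (at X)"
      by (auto simp: frechet_derivative_at[symmetric] differentiable_def)
    define Y where "Y = y 1 X"
    have Y0: "Y > 0" using y0 by (simp add: Y_def)
    \<comment> \<open>The Jacobian determinant of a projective map is \<open>det A / Y^3\<close>.\<close>
    have "det (matrix D) * Y^4 =
        (A$2$2 * Y - y 2 X * A$1$2) * (A$3$3 * Y - y 3 X * A$1$3) - (A$2$3 * Y - y 2 X * A$1$3) * (A$3$2 * Y - y 3 X * A$1$2)"
      using Y0 by (simp add: det_2 matrix_def D_def axis_def Y_def[symmetric] field_simps eval_nat_numeral)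
    also have "\<dots> = det A * Y"
      unfolding det_3 Y_def y_def by algebra
    finally have "det (matrix D) * Y^4 > 0" using d Y0 by simp
    then have "det (matrix D) > 0" using Y0 by (simp add: zero_less_mult_iff)
    with fd df show ?thesis by (simp add: jacobian_def)
  qed
  then show ?thesis using hyp_isometry_lorentz_map[OF A] by (simp add: hyp_motion_def)
qed

section \<open>Generalized sine and arc length\<close>

text \<open>The functions \<open>sn k\<close> and \<open>cs k\<close> are the solutions of \<open>f'' = - k f\<close> with
  the initial values of sine and cosine; \<open>sn k\<close> has period \<open>2 pi / sqrt k\<close> if
  \<open>k > 0\<close> and is increasing otherwise.\<close>

definition sn :: "real \<Rightarrow> real \<Rightarrow> real" where
  "sn k x = (if k > 0 then sin (sqrt k * x) / sqrt k
     else if k = 0 then x else sinh (sqrt (- k) * x) / sqrt (- k))"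

definition cs :: "real \<Rightarrow> real \<Rightarrow> real" where
  "cs k x = (if k > 0 then cos (sqrt k * x) else if k = 0 then 1 else cosh (sqrt (- k) * x))"

lemma sn_0 [simp]: "sn k 0 = 0" and cs_0 [simp]: "cs k 0 = 1"
  by (simp_all add: sn_def cs_def)

lemma sn_minus [simp]: "sn k (- x) = - sn k x" and cs_minus [simp]: "cs k (- x) = cs k x"
  by (simp_all add: sn_def cs_def)

lemma cs_sn_square: "(cs k x)\<^sup>2 + k * (sn k x)\<^sup>2 = 1"
  using hyperbolic_pythagoras[of "sqrt (- k) * x"]
  by (auto simp: sn_def cs_def power_divide)

lemma cs_square: "(cs k x)\<^sup>2 = 1 - k * (sn k x)\<^sup>2"
  using cs_sn_square[of k x] by simp

lemma sn_add: "sn k (x + y) = sn k x * cs k y + cs k x * sn k y"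
  by (simp add: sn_def cs_def distrib_left sin_add sinh_add add_divide_distrib)

lemma sn_diff: "sn k (x - y) = sn k x * cs k y - cs k x * sn k y"
  using sn_add[of k x "- y"] by simp

lemma sn_pos: "x > 0 \<Longrightarrow> (k > 0 \<Longrightarrow> sqrt k * x < pi) \<Longrightarrow> sn k x > 0"
  by (auto simp: sn_def intro!: sin_gt_zero divide_pos_pos)

text \<open>The range in which \<open>sn k\<close> increases and \<open>cs k\<close> is nonnegative.\<close>

definition principal :: "real \<Rightarrow> real \<Rightarrow> bool" where
  "principal k x \<longleftrightarrow> 0 \<le> x \<and> (k > 0 \<longrightarrow> sqrt k * x \<le> pi / 2)"

lemma principal_mono:
  assumes "principal k y" "0 \<le> x" "x \<le> y"
  shows "principal k x"
proof -
  have "sqrt k * x \<le> sqrt k * y" if "k > 0" using that assms(3) by simp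
  with assms show ?thesis unfolding principal_def by linarith
qed

lemma principal_less_pi: "principal k x \<Longrightarrow> k > 0 \<Longrightarrow> sqrt k * x < pi"
  using pi_gt_zero unfolding principal_def by linarith

lemma sn_strict_mono:
  assumes "principal k y" "0 \<le> x" "x < y"
  shows "sn k x < sn k y"
proof -
  consider "k > 0" | "k = 0" | "k < 0" by linarith
  then show ?thesis
  proof cases
    case 1
    then have "0 \<le> sqrt k * x" "sqrt k * x < sqrt k * y" "sqrt k * y \<le> pi / 2"
      using assms by (auto simp: principal_def)
    then have "sin (sqrt k * x) < sin (sqrt k * y)" by (intro sin_monotone_2pi) auto
    then show ?thesis using 1 by (simp add: sn_def divide_strict_right_mono)
  qed (use assms in \<open>simp_all add: sn_def divide_strict_right_mono\<close>)
qed

lemma sn_mono: "principal k y \<Longrightarrow> 0 \<le> x \<Longrightarrow> x \<le> y \<Longrightarrow> sn k x \<le> sn k y"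
  using sn_strict_mono[of k y x] by (cases "x = y") auto

lemma sn_inj: "principal k x \<Longrightarrow> principal k y \<Longrightarrow> sn k x = sn k y \<Longrightarrow> x = y"
  using sn_strict_mono[of k x y] sn_strict_mono[of k y x]
  by (cases x y rule: linorder_cases) (auto simp: principal_def)

lemma sn_nonneg: "principal k x \<Longrightarrow> sn k x \<ge> 0"
  using sn_mono[of k x 0] by (auto simp: principal_def)

lemma sn_principal_pos: "principal k x \<Longrightarrow> x \<noteq> 0 \<Longrightarrow> sn k x > 0"
  using sn_strict_mono[of k x 0] by (auto simp: principal_def)

lemma cs_nonneg: "principal k x \<Longrightarrow> cs k x \<ge> 0"
proof (cases "k > 0")
  case True
  assume "principal k x"
  then have "0 \<le> sqrt k * x" "sqrt k * x \<le> pi / 2" using True by (auto simp: principal_def)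
  then have "cos (sqrt k * x) \<ge> 0" using pi_gt_zero by (intro cos_ge_zero) linarith+
  then show ?thesis using True by (simp add: cs_def)
qed (simp add: cs_def)

text \<open>Within half a period the sine does not decrease to a later value unless it has passed its
  maximum; so an arc shorter than another one, but with a chord that is not longer, is at most a
  quarter of the full period.\<close>

lemma principal_if_sn_le:
  assumes "0 \<le> x" "x < y" "sn k x \<le> sn k y" "k > 0 \<Longrightarrow> sqrt k * y \<le> pi"
  shows "principal k x"
proof (rule ccontr)
  assume "\<not> principal k x"
  then have k: "k > 0" "sqrt k * x > pi / 2" using assms by (auto simp: principal_def)
  have "sqrt k * x < sqrt k * y" using k assms by simp
  then have "sin (sqrt k * y) < sin (sqrt k * x)"
    using sin_monotone_2pi[of "sqrt k * x - pi / 2" "sqrt k * y - pi / 2"]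
      sin_monotone_2pi[of "pi - sqrt k * y" "pi - sqrt k * x"] assms(4)[OF k(1)] k by simp
  then show False using assms(3) k by (simp add: sn_def divide_le_cancel)
qed

definition arcsn :: "real \<Rightarrow> real \<Rightarrow> real" where
  "arcsn k s = (if k > 0 then arcsin (sqrt k * s) / sqrt k
     else if k = 0 then s else arsinh (sqrt (- k) * s) / sqrt (- k))"

lemma sqrt_mult_le_1:
  assumes "k > 0" "s \<ge> 0" "k * s\<^sup>2 \<le> 1"
  shows "0 \<le> sqrt k * s" "sqrt k * s \<le> 1" "- 1 \<le> sqrt k * s"
proof -
  show "0 \<le> sqrt k * s" using assms by simp
  then show "- 1 \<le> sqrt k * s" by linarith
  have "(sqrt k * s)\<^sup>2 \<le> 1\<^sup>2" using assms by (simp add: power_mult_distrib)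
  then show "sqrt k * s \<le> 1" by (rule power2_le_imp_le) simp
qed

lemma arcsn:
  assumes "s \<ge> 0" "k * s\<^sup>2 \<le> 1"
  shows sn_arcsn: "sn k (arcsn k s) = s" and principal_arcsn: "principal k (arcsn k s)"
proof -
  have "sn k (arcsn k s) = s \<and> principal k (arcsn k s)"
  proof (cases "k > 0")
    case True
    note b = sqrt_mult_le_1[OF True assms]
    have "0 \<le> arcsin (sqrt k * s)" "arcsin (sqrt k * s) \<le> pi / 2"
      using b arcsin_le_arcsin[of 0 "sqrt k * s"] arcsin_bounded[of "sqrt k * s"] by auto
    then show ?thesis using True b by (simp add: arcsn_def sn_def principal_def arcsin)
  next
    case False
    have "0 \<le> arsinh (sqrt (- k) * s)"
      using assms False by (simp only: arsinh_real_neg_iff flip: not_less) (simp add: not_less)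
    then show ?thesis using assms False
      by (simp add: arcsn_def sn_def principal_def)
  qed
  then show "sn k (arcsn k s) = s" "principal k (arcsn k s)" by auto
qed

lemma arcsn_sn: "principal k x \<Longrightarrow> arcsn k (sn k x) = x"
  using cs_square[of k x] sn_nonneg[of k x] zero_le_power2[of "cs k x"]
  by (intro sn_inj[of k "arcsn k (sn k x)" x] arcsn) auto

lemma arcsn_pos: "s > 0 \<Longrightarrow> k * s\<^sup>2 \<le> 1 \<Longrightarrow> arcsn k s > 0"
  using arcsn[of s k] by (cases "arcsn k s = 0") (auto simp: principal_def)

lemma arcsn_mono:
  assumes "0 \<le> s" "s \<le> t" "k * t\<^sup>2 \<le> 1" "k * s\<^sup>2 \<le> 1"
  shows "arcsn k s \<le> arcsn k t"
  using assms arcsn[of s k] arcsn[of t k] sn_strict_mono[of k "arcsn k s" "arcsn k t"]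
  by (force simp: principal_def not_less[symmetric])

lemma sn_half_turn: "k > 0 \<Longrightarrow> sn k (pi / sqrt k - x) = sn k x"
  by (simp add: sn_def right_diff_distrib)

lemma sn_eq_cases:
  assumes "0 \<le> x" "k > 0 \<Longrightarrow> sqrt k * x \<le> pi" "sn k x = s"
  shows "x = arcsn k s \<or> k > 0 \<and> x = pi / sqrt k - arcsn k s"
proof (cases "principal k x")
  case True
  then show ?thesis using arcsn_sn assms(3) by metis
next
  case False
  then have k: "k > 0" "sqrt k * x > pi / 2" using assms by (auto simp: principal_def)
  have "principal k (pi / sqrt k - x)"
    using k assms(2)[OF k(1)]
    by (simp add: principal_def right_diff_distrib pos_le_divide_eq mult.commute)
  then have "arcsn k s = pi / sqrt k - x" using arcsn_sn sn_half_turn[OF k(1)] assms(3) by metis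
  then show ?thesis using k by simp
qed

text \<open>Away from \<open>k = 0\<close> the function is elementary. At \<open>k = 0\<close> both one-sided limits are
  derivatives at the origin, of \<open>arcsin (y s)\<close> and of \<open>arsinh (y s)\<close> with
  \<open>y = sqrt \<bar>k\<bar>\<close>.\<close>

lemma continuous_on_arcsn:
  assumes s: "s > 0"
  shows "continuous_on {k. k * s\<^sup>2 \<le> 1} (\<lambda>k. arcsn k s)"
proof -
  let ?S = "{k. k * s\<^sup>2 \<le> 1}"
  have "continuous (at k within ?S) (\<lambda>k. arcsn k s)" if k: "k \<in> ?S" for k
  proof -
    consider "k > 0" | "k = 0" | "k < 0" by linarith
    then show ?thesis
    proof cases
      case 1
      have "- 1 \<le> sqrt k * s \<and> sqrt k * s \<le> 1" if "k \<in> {0<..} \<inter> ?S" for k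
        using sqrt_mult_le_1[of k s] that s by simp
      then have "continuous_on ({0<..} \<inter> ?S) (\<lambda>k. arcsin (sqrt k * s) / sqrt k)"
        by (intro continuous_intros ballI) auto
      then have "continuous_on ({0<..} \<inter> ?S) (\<lambda>k. arcsn k s)"
        by (rule continuous_on_eq) (simp add: arcsn_def)
      then have "continuous (at k within {0<..} \<inter> ?S) (\<lambda>k. arcsn k s)"
        using 1 k by (simp add: continuous_on_eq_continuous_within)
      moreover have "at k within {0<..} \<inter> ?S = at k within ?S"
        by (rule at_within_nhd[of _ "{0<..}"]) (use 1 in auto)
      ultimately show ?thesis by simp
    next
      case 3
      have "continuous_on {..<0} (\<lambda>k. arsinh (sqrt (- k) * s) / sqrt (- k))"
        by (auto intro!: continuous_intros)
      then have "continuous_on {..<0} (\<lambda>k. arcsn k s)"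
        by (rule continuous_on_eq) (simp add: arcsn_def)
      then have "isCont (\<lambda>k. arcsn k s) k"
        using 3 by (simp add: continuous_on_eq_continuous_at)
      then show ?thesis by (rule continuous_at_imp_continuous_at_within)
    next
      case 2
      have "((\<lambda>y. arcsin (y * s)) has_field_derivative s) (at 0)"
        by (auto intro!: derivative_eq_intros)
      then have a: "((\<lambda>y. arcsin (y * s) / y) \<longlongrightarrow> s) (at 0)"
        by (simp add: has_field_derivative_iff)
      have "((\<lambda>y. arsinh (y * s)) has_field_derivative 1 / sqrt ((0 * s)\<^sup>2 + 1) * s) (at 0)"
        by (rule DERIV_chain2[OF arsinh_real_has_field_derivative])
          (auto intro!: derivative_eq_intros)
      then have "((\<lambda>y. arsinh (y * s)) has_field_derivative s) (at 0)" by simp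
      then have b: "((\<lambda>y. arsinh (y * s) / y) \<longlongrightarrow> s) (at 0)"
        by (simp add: has_field_derivative_iff)
      have r: "filterlim sqrt (at 0) (at_right 0)"
        by (auto simp: filterlim_at eventually_at_filter intro!: tendsto_eq_intros)
      have l: "filterlim (\<lambda>k. sqrt (- k)) (at 0) (at_left 0)"
        by (auto simp: filterlim_at eventually_at_filter intro!: tendsto_eq_intros)
      have "((\<lambda>k. arcsn k s) \<longlongrightarrow> s) (at_right 0)"
        using filterlim_compose[OF a r]
        by (rule Lim_transform_eventually) (auto simp: eventually_at_filter arcsn_def)
      moreover have "((\<lambda>k. arcsn k s) \<longlongrightarrow> s) (at_left 0)"
        using filterlim_compose[OF b l]
        by (rule Lim_transform_eventually) (auto simp: eventually_at_filter arcsn_def)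
      ultimately have "((\<lambda>k. arcsn k s) \<longlongrightarrow> s) (at 0)"
        by (simp add: filterlim_split_at)
      then have "isCont (\<lambda>k. arcsn k s) 0" by (simp add: isCont_def arcsn_def)
      then show ?thesis unfolding 2 by (rule continuous_at_imp_continuous_at_within)
    qed
  qed
  then show ?thesis by (simp add: continuous_on_eq_continuous_within)
qed

section \<open>Inscribed polygons in terms of circle parameters\<close>

text \<open>The parameters of the vertices of a convex polygon with \<open>N + 1\<close> sides on a circle with
  invariant \<open>k\<close>. The side from the last vertex back to the first corresponds to the negative
  parameter difference \<open>- \<alpha> N\<close>; for \<open>k > 0\<close> this is, up to a full turn
  \<open>pi / sqrt k\<close>, the remaining arc of the circle.\<close>

definition inscribed :: "real \<Rightarrow> nat \<Rightarrow> (nat \<Rightarrow> real) \<Rightarrow> (nat \<Rightarrow> real) \<Rightarrow> bool" where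
  "inscribed k N s \<alpha> \<longleftrightarrow> \<alpha> 0 = 0 \<and> (\<forall>i<N. \<alpha> i < \<alpha> (Suc i)) \<and> (k > 0 \<longrightarrow> sqrt k * \<alpha> N < pi) \<and>
     (\<forall>i<N. sn k (\<alpha> (Suc i) - \<alpha> i) = s i) \<and> sn k (\<alpha> N) = s N"

text \<open>The largest admissible \<open>k\<close> is \<open>m = 1 / (s N)\<^sup>2\<close>, for which the longest side is a diameter.
  If its arc is there at least as long as the sum of the other arcs, the two sides of the equation
  cross for some \<open>k\<close> in between. Otherwise all arcs together exceed one turn for
  \<open>k = m\<close>, while they become negligible compared with a turn as \<open>k\<close> tends to \<open>0\<close>; so
  they make up exactly one turn for some \<open>k\<close>, and the center is on the inner side of the longest
  side.\<close>

lemma inscribed_exists: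
  assumes N: "N \<ge> 2" and pos: "\<And>i. i \<le> N \<Longrightarrow> s i > 0" and le: "\<And>i. i < N \<Longrightarrow> s i \<le> s N"
    and ineq: "arsinh (s N) < (\<Sum>i<N. arsinh (s i))"
  shows "\<exists>k>-1. \<exists>\<alpha>. inscribed k N s \<alpha>"
proof -
  define m where "m = 1 / (s N)\<^sup>2"
  have sN: "s N > 0" using pos by simp
  have m0: "m > 0" "m * (s N)\<^sup>2 = 1" using sN by (auto simp: m_def)
  have sq: "(s i)\<^sup>2 \<le> (s N)\<^sup>2" if "i \<le> N" for i
    using le[of i] pos[of i] that by (cases "i = N") (auto intro!: power_mono)
  have dom: "k * (s i)\<^sup>2 \<le> 1" if "k \<le> m" "i \<le> N" for i k
  proof (cases "k \<ge> 0")
    case True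
    then have "k * (s i)\<^sup>2 \<le> m * (s N)\<^sup>2" using sq[OF that(2)] that m0 by (intro mult_mono) auto
    then show ?thesis using m0 by simp
  next
    case False
    then have "k * (s i)\<^sup>2 \<le> 0" by (intro mult_nonpos_nonneg) auto
    then show ?thesis by linarith
  qed
  have build: "\<exists>\<alpha>. inscribed k N s \<alpha>"
    if k: "k \<le> m" and tot: "sn k (\<Sum>i<N. arcsn k (s i)) = s N"
      "k > 0 \<Longrightarrow> sqrt k * (\<Sum>i<N. arcsn k (s i)) < pi" for k
  proof (rule exI[of _ "\<lambda>j. \<Sum>i<j. arcsn k (s i)"])
    have "arcsn k (s i) > 0" "sn k (arcsn k (s i)) = s i" if "i < N" for i
      using arcsn_pos sn_arcsn dom[OF k, of i] pos[of i] that by (simp_all add: less_imp_le)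
    with tot show "inscribed k N s (\<lambda>j. \<Sum>i<j. arcsn k (s i))"
      by (simp add: inscribed_def)
  qed
  define F where "F k = (\<Sum>i<N. arcsn k (s i)) - arcsn k (s N)" for k
  have cont: "continuous_on {-1..m} F"
    unfolding F_def
    by (intro continuous_intros continuous_on_subset[OF continuous_on_arcsn])
      (use pos dom in auto)
  have F1: "F (-1) > 0" using ineq by (simp add: F_def arcsn_def)
  show ?thesis
  proof (cases "F m \<le> 0")
    case True
    have "\<exists>k\<ge>-1. k \<le> m \<and> F k = 0"
      using cont True F1 m0 by (intro IVT2') auto
    then obtain k where k: "k \<ge> -1" "k \<le> m" "F k = 0" by blast
    have "k > -1" using k F1 by (cases "k = -1") auto
    moreover have tot: "(\<Sum>i<N. arcsn k (s i)) = arcsn k (s N)" using k(3) by (simp add: F_def)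
    have "\<exists>\<alpha>. inscribed k N s \<alpha>"
    proof (rule build)
      show "sn k (\<Sum>i<N. arcsn k (s i)) = s N"
        unfolding tot using sn_arcsn dom k sN by simp
      show "sqrt k * (\<Sum>i<N. arcsn k (s i)) < pi" if "k > 0"
        unfolding tot using dom[of k N] k(2) sN that by (simp add: principal_arcsn principal_less_pi)
    qed (use k in simp)
    ultimately show ?thesis by blast
  next
    case False
    \<comment> \<open>The arcs measured as angles: this has no singularity at \<open>k = 0\<close>.\<close>
    define G where "G k = (\<Sum>i\<le>N. arcsin (sqrt k * s i))" for k
    have G_arcsn: "G k = sqrt k * ((\<Sum>i<N. arcsn k (s i)) + arcsn k (s N))" if "k > 0" for k
      using that by (simp add: G_def arcsn_def sum_distrib_left distrib_left flip: lessThan_Suc_atMost)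
    have am: "sqrt m * arcsn m (s N) = pi / 2"
      using sN m0 by (simp add: arcsn_def m_def real_sqrt_divide)
    have "sqrt m * F m > 0" using False m0 by simp
    then have "G m \<ge> pi"
      using am by (simp add: G_arcsn[OF m0(1)] F_def algebra_simps)
    moreover have "G 0 \<le> pi" by (simp add: G_def)
    moreover have "continuous_on {0..m} G"
    proof -
      have "- 1 \<le> sqrt k * s i \<and> sqrt k * s i \<le> 1" if "k \<in> {0..m}" "i \<le> N" for k i
        using sqrt_mult_le_1[of k "s i"] dom[of k i] pos[of i] that by (cases "k = 0") (simp_all add: less_imp_le)
      then show ?thesis unfolding G_def by (auto intro!: continuous_intros)
    qed
    ultimately have "\<exists>k\<ge>0. k \<le> m \<and> G k = pi"
      using m0 by (intro IVT') auto
    then obtain k where k: "k \<ge> 0" "k \<le> m" "G k = pi" by blast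
    have k0: "k > 0" using k by (cases "k = 0") (auto simp: G_def)
    have tot: "(\<Sum>i<N. arcsn k (s i)) = pi / sqrt k - arcsn k (s N)"
      using k(3) k0 by (simp add: G_arcsn field_simps)
    have "\<exists>\<alpha>. inscribed k N s \<alpha>"
    proof (rule build)
      show "sn k (\<Sum>i<N. arcsn k (s i)) = s N"
        unfolding tot sn_half_turn[OF k0] using sn_arcsn dom k sN by simp
      show "sqrt k * (\<Sum>i<N. arcsn k (s i)) < pi"
        unfolding tot using arcsn_pos[of "s N" k] dom[of k N] k sN k0
        by (simp add: right_diff_distrib)
    qed (use k in simp)
    then show ?thesis using k0 by force
  qed
qed

text \<open>Put \<open>u\<close>, \<open>v\<close> for the arcs with parameter \<open>k\<close> over the same chords as \<open>x\<close>,
  \<open>y\<close>. In the addition theorem for \<open>sn\<close> the sines agree, while the cosines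
  \<open>sqrt (1 - k s\<^sup>2)\<close> are larger for the smaller parameter; hence
  \<open>sn k (u + v) > sn k' (x + y)\<close>.\<close>

lemma arcsn_sn_subadditive:
  assumes kk: "k < k'" and pos: "x > 0" "y > 0" and pr: "principal k' (x + y)"
  shows "arcsn k (sn k' (x + y)) < arcsn k (sn k' x) + arcsn k (sn k' y)"
proof -
  have *: "principal k (arcsn k (sn k' z)) \<and> sn k (arcsn k (sn k' z)) = sn k' z" if "principal k' z" for z
  proof -
    have "k * (sn k' z)\<^sup>2 \<le> k' * (sn k' z)\<^sup>2" using kk by (intro mult_right_mono) auto
    also have "\<dots> \<le> 1" using cs_square[of k' z] zero_le_power2[of "cs k' z"] by linarith
    finally show ?thesis using arcsn[of "sn k' z" k] sn_nonneg[OF that] by auto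
  qed
  define u v w where "u = arcsn k (sn k' x)" "v = arcsn k (sn k' y)" "w = arcsn k (sn k' (x + y))"
  note defs = this
  have px: "principal k' x" "principal k' y" using principal_mono[OF pr] pos by auto
  have u: "principal k u" "sn k u = sn k' x" and v: "principal k v" "sn k v = sn k' y"
    and w: "principal k w" "sn k w = sn k' (x + y)"
    using * px pr by (auto simp: defs)
  have s0: "sn k' x > 0" "sn k' y > 0" using sn_principal_pos px pos by auto
  have less: "cs k' z' < cs k z" if "principal k z" "principal k' z'" "sn k z = sn k' z'" "sn k z > 0" for z z'
  proof -
    have "k * (sn k' z')\<^sup>2 < k' * (sn k' z')\<^sup>2" using kk that by (intro mult_strict_right_mono) auto
    then have "(cs k' z')\<^sup>2 < (cs k z)\<^sup>2" unfolding cs_square that(3) by simp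
    then show ?thesis using cs_nonneg[OF that(1)] by (rule power2_less_imp_less)
  qed
  have "cs k' x < cs k u" "cs k' y < cs k v" using less u v px s0 by auto
  then have "sn k' (x + y) < sn k (u + v)"
    unfolding sn_add u v using s0 by (intro add_strict_mono) auto
  then have "\<not> u + v \<le> w"
    using sn_mono[OF w(1), of "u + v"] u v w by (auto simp: principal_def)
  then show ?thesis by (simp add: defs)
qed

lemma arcsn_sn_subadditive_sum:
  fixes x :: "nat \<Rightarrow> real"
  assumes kk: "k < k'" and N: "N \<ge> 2" and pos: "\<And>i. i < N \<Longrightarrow> x i > 0"
    and pr: "principal k' (\<Sum>i<N. x i)"
  shows "arcsn k (sn k' (\<Sum>i<N. x i)) < (\<Sum>i<N. arcsn k (sn k' (x i)))"
  using N pos pr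
proof (induction N rule: nat_induct_at_least)
  case base
  then show ?case using arcsn_sn_subadditive[OF kk, of "x 0" "x 1"] by (simp add: numeral_2_eq_2)
next
  case (Suc n)
  have p: "(\<Sum>i<n. x i) > 0" using Suc by (intro sum_pos) (auto simp: lessThan_empty_iff)
  have "principal k' (\<Sum>i<n. x i)"
    using principal_mono[OF Suc.prems(2)] p Suc.prems(1)[of n] by simp
  then have "arcsn k (sn k' (\<Sum>i<n. x i)) < (\<Sum>i<n. arcsn k (sn k' (x i)))"
    using Suc by simp
  moreover have "arcsn k (sn k' ((\<Sum>i<n. x i) + x n)) < arcsn k (sn k' (\<Sum>i<n. x i)) + arcsn k (sn k' (x n))"
    using arcsn_sn_subadditive[OF kk p] Suc.prems by simp
  ultimately show ?case by simp
qed

lemma inscribed_mono: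
  assumes "inscribed k N s \<alpha>" "i < j" "j \<le> N"
  shows "\<alpha> i < \<alpha> j"
  using assms(2,3)
proof (induction j)
  case (Suc j)
  moreover have "\<alpha> j < \<alpha> (Suc j)" using Suc.prems assms(1) by (simp add: inscribed_def)
  ultimately show ?case by (cases "i = j") auto
qed simp

text \<open>Every short side spans a principal arc: its arc is strictly shorter than \<open>\<alpha> N\<close>, because there
  are at least two short sides, but its chord is not longer.\<close>

lemma inscribed_arcsn:
  assumes i: "inscribed k N s \<alpha>" and N: "N \<ge> 2" and le: "\<And>i. i < N \<Longrightarrow> s i \<le> s N"
  shows inscribed_total: "\<alpha> N = (\<Sum>i<N. arcsn k (s i))"
    and inscribed_sum: "j \<le> N \<Longrightarrow> \<alpha> j = (\<Sum>i<j. arcsn k (s i))"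
proof -
  have i': "\<alpha> 0 = 0" "\<And>j. j < N \<Longrightarrow> \<alpha> j < \<alpha> (Suc j)" "k > 0 \<Longrightarrow> sqrt k * \<alpha> N < pi"
     "\<And>j. j < N \<Longrightarrow> sn k (\<alpha> (Suc j) - \<alpha> j) = s j" "sn k (\<alpha> N) = s N"
    using i by (auto simp: inscribed_def)
  have st: "\<alpha> (Suc j) - \<alpha> j = arcsn k (s j)" if j: "j < N" for j
  proof -
    have "\<alpha> (Suc j) - \<alpha> j < \<alpha> N"
      using inscribed_mono[OF i, of 0 j] inscribed_mono[OF i, of "Suc j" N] i' j N
      by (cases "j = 0"; cases "Suc j = N") auto
    then have "principal k (\<alpha> (Suc j) - \<alpha> j)"
      using i' le j by (intro principal_if_sn_le[of _ "\<alpha> N"]) (auto simp: less_imp_le)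
    then show ?thesis using arcsn_sn i'(4)[OF j] by metis
  qed
  show su: "\<alpha> j = (\<Sum>i<j. arcsn k (s i))" if "j \<le> N" for j
    using that
  proof (induction j)
    case (Suc j)
    then show ?case using st[of j] by simp
  qed (simp add: i')
  then show "\<alpha> N = (\<Sum>i<N. arcsn k (s i))" by simp
qed

text \<open>The arc \<open>\<alpha> N\<close> is either the principal arc \<open>P\<close> over the longest side or its complement to
  a turn. In the first case subadditivity makes the short arcs for \<open>k\<close> add up to more
  than \<open>P\<close>. In the second case all arcs make up one turn for \<open>k\<close>; measured as angles they
  increase with \<open>k\<close>, and would exceed one turn for \<open>k'\<close>.\<close>

lemma inscribed_curvature_not_less:
  assumes i: "inscribed k N s \<alpha>" and i': "inscribed k' N s \<alpha>'" and N: "N \<ge> 2"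
    and pos: "\<And>i. i \<le> N \<Longrightarrow> s i > 0" and le: "\<And>i. i < N \<Longrightarrow> s i \<le> s N"
  shows "\<not> k < k'"
proof
  assume kk: "k < k'"
  have aN: "\<alpha> N > 0" "\<alpha>' N > 0" using inscribed_mono[OF i, of 0 N] inscribed_mono[OF i', of 0 N] i i' N
    by (auto simp: inscribed_def)
  have sN: "sn k (\<alpha> N) = s N" "sn k' (\<alpha>' N) = s N"
    and pi: "k > 0 \<Longrightarrow> sqrt k * \<alpha> N \<le> pi" "k' > 0 \<Longrightarrow> sqrt k' * \<alpha>' N \<le> pi"
    using i i' by (auto simp: inscribed_def)
  have dom': "k' * (s i)\<^sup>2 \<le> 1" if "i \<le> N" for i
  proof -
    have "(s i)\<^sup>2 \<le> (s N)\<^sup>2" using le[of i] pos[of i] that by (cases "i = N") (auto intro!: power_mono)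
    moreover have "k' * (s N)\<^sup>2 \<le> 1" using cs_square[of k' "\<alpha>' N"] sN zero_le_power2[of "cs k' (\<alpha>' N)"] by simp
    moreover have "k' * (s i)\<^sup>2 \<le> 0" if "k' \<le> 0" using that by (intro mult_nonpos_nonneg) auto
    ultimately show ?thesis by (smt (verit) mult_left_mono)
  qed
  have dom: "k * (s i)\<^sup>2 \<le> 1" if "i \<le> N" for i
    using dom'[OF that] kk mult_right_mono[of k k' "(s i)\<^sup>2"] by simp
  define P where "P = arcsn k (s N)"
  define P' where "P' = arcsn k' (s N)"
  have P': "principal k' P'" "sn k' P' = s N" "P' > 0"
    using arcsn[of "s N" k'] arcsn_pos[of "s N" k'] dom'[of N] pos[of N] by (auto simp: P'_def)
  have c': "\<alpha>' N = P' \<or> k' > 0 \<and> \<alpha>' N = pi / sqrt k' - P'"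
    using sn_eq_cases[of "\<alpha>' N" k' "s N"] aN sN pi by (auto simp: P'_def)
  have PaN: "P' \<le> \<alpha>' N" using c'
  proof
    assume h: "k' > 0 \<and> \<alpha>' N = pi / sqrt k' - P'"
    then have "P' \<le> pi / 2 / sqrt k'"
      using P'(1) by (simp add: principal_def pos_le_divide_eq mult.commute)
    then show ?thesis using h by simp
  qed simp
  have tot: "\<alpha> N = (\<Sum>i<N. arcsn k (s i))" "\<alpha>' N = (\<Sum>i<N. arcsn k' (s i))"
    using inscribed_total[OF i N le] inscribed_total[OF i' N le] by auto
  consider "\<alpha> N = P" | "k > 0" "\<alpha> N = pi / sqrt k - P"
    using sn_eq_cases[of "\<alpha> N" k "s N"] aN sN pi by (auto simp: P_def)
  then show False
  proof cases
    case 1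
    \<comment> \<open>If \<open>\<alpha>' N\<close> is the complementary arc, the short arcs for \<open>k'\<close> are shrunk so that
      they add up to the principal arc \<open>P'\<close>, where subadditivity applies; shrinking
      only decreases the corresponding arcs for \<open>k\<close>.\<close>
    define c where "c = P' / \<alpha>' N"
    have c: "c > 0" "c \<le> 1" using PaN P' aN by (auto simp: c_def)
    define x where "x i = c * arcsn k' (s i)" for i
    have sx: "(\<Sum>i<N. x i) = P'"
      unfolding x_def sum_distrib_left[symmetric] tot(2)[symmetric] using aN by (simp add: c_def)
    have "P = arcsn k (sn k' (\<Sum>i<N. x i))" by (simp add: sx P' P_def)
    also have "\<dots> < (\<Sum>i<N. arcsn k (sn k' (x i)))"
      using arcsn_pos dom' pos c P' N
      by (intro arcsn_sn_subadditive_sum[OF kk]) (simp_all add: sx, simp add: x_def)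
    also have "\<dots> \<le> (\<Sum>i<N. arcsn k (s i))"
    proof (rule sum_mono)
      fix j assume "j \<in> {..<N}"
      then have j: "j \<le> N" by simp
      have a: "principal k' (arcsn k' (s j))" "sn k' (arcsn k' (s j)) = s j" "arcsn k' (s j) > 0"
        using arcsn[of "s j" k'] arcsn_pos[of "s j" k'] pos[OF j] dom'[OF j] by auto
      have x: "0 \<le> x j" "x j \<le> arcsn k' (s j)" using c a by (auto simp: x_def mult_le_cancel_right1)
      have "sn k' (x j) \<le> s j" using sn_mono[OF a(1) x] a by simp
      moreover have "sn k' (x j) \<ge> 0" using sn_nonneg principal_mono[OF a(1) x] by blast
      moreover from this calculation have "k * (sn k' (x j))\<^sup>2 \<le> 1"
        using dom[OF j] power_mono[of "sn k' (x j)" "s j" 2] zero_le_power2[of "sn k' (x j)"]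
        by (smt (verit) mult_left_mono mult_nonpos_nonneg)
      ultimately show "arcsn k (sn k' (x j)) \<le> arcsn k (s j)"
        using arcsn_mono dom[OF j] by blast
    qed
    also have "\<dots> = P" using tot 1 by simp
    finally show False by simp
  next
    case 2
    have k': "k' > 0" using kk 2 by simp
    have lt: "sqrt k * arcsn k (s j) < sqrt k' * arcsn k' (s j)" if j: "j \<le> N" for j
    proof -
      have "sqrt k * s j < sqrt k' * s j" using kk pos[OF j] by simp
      then have "arcsin (sqrt k * s j) < arcsin (sqrt k' * s j)"
        using sqrt_mult_le_1[of k "s j"] sqrt_mult_le_1[of k' "s j"] dom[OF j] dom'[OF j] 2 k' pos[OF j]
        by (intro arcsin_less_arcsin) auto
      then show ?thesis using 2 k' by (simp add: arcsn_def)
    qed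
    have "pi = sqrt k * (\<Sum>i\<le>N. arcsn k (s i))"
      using 2 tot by (simp add: P_def field_simps flip: lessThan_Suc_atMost)
    also have "\<dots> = (\<Sum>i\<le>N. sqrt k * arcsn k (s i))" by (simp add: sum_distrib_left)
    also have "\<dots> < (\<Sum>i\<le>N. sqrt k' * arcsn k' (s i))"
      using lt by (intro sum_strict_mono) auto
    also have "\<dots> = sqrt k' * (\<Sum>i\<le>N. arcsn k' (s i))" by (simp add: sum_distrib_left)
    also have "\<dots> = sqrt k' * (\<alpha>' N + P')" by (simp add: tot P'_def flip: lessThan_Suc_atMost)
    also have "\<dots> \<le> pi" using c' P' k' by (auto simp: distrib_left principal_def right_diff_distrib)
    finally show False by simp
  qed
qed

lemma inscribed_unique:
  assumes "inscribed k N s \<alpha>" "inscribed k' N s \<alpha>'" "N \<ge> 2"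
    and "\<And>i. i \<le> N \<Longrightarrow> s i > 0" "\<And>i. i < N \<Longrightarrow> s i \<le> s N"
  shows "k' = k" "\<And>j. j \<le> N \<Longrightarrow> \<alpha>' j = \<alpha> j"
proof -
  show k: "k' = k"
    using inscribed_curvature_not_less[OF assms] inscribed_curvature_not_less[OF assms(2,1,3-)] by force
  show "\<alpha>' j = \<alpha> j" if "j \<le> N" for j
    using inscribed_sum[OF assms(1,3,5)] inscribed_sum[OF assms(2,3,5)] k that by simp
qed

section \<open>A normal form for circles of all three types\<close>

definition circle_point :: "real \<Rightarrow> real \<Rightarrow> real^3" where
  "circle_point k a = vector [1 + 2 * (sn k a)\<^sup>2, 2 * sn k a * cs k a, 2 * sqrt (1 + k) * (sn k a)\<^sup>2]"

lemma circle_point_nth [simp]: "circle_point k a $ 1 = 1 + 2 * (sn k a)\<^sup>2"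
  "circle_point k a $ 2 = 2 * sn k a * cs k a" "circle_point k a $ 3 = 2 * sqrt (1 + k) * (sn k a)\<^sup>2"
  by (simp_all add: circle_point_def vector_3)

text \<open>Chords of the circle depend only on the parameter difference, as they must: up to
  a factor, the parameter is half the angle of rotation about the center if \<open>k > 0\<close>, and a
  parameter of a group of parabolic motions or of translations otherwise.\<close>

lemma lform_circle_point:
  assumes "k \<ge> -1"
  shows "lform (circle_point k a) (circle_point k b) = 1 + 2 * (sn k (a - b))\<^sup>2"
proof -
  define w where "w = sqrt (1 + k)"
  have w: "w * w = 1 + k" using assms by (simp add: w_def)
  show ?thesis
    unfolding lform_def circle_point_nth w_def[symmetric] sn_diff using w cs_square[of k a] cs_square[of k b]
    by algebra
qed

lemma circle_point_hyperboloid: "k \<ge> -1 \<Longrightarrow> circle_point k a \<in> hyperboloid"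
  by (simp add: hyperboloid_def lform_circle_point add_pos_nonneg)

lemma det3_circle_point:
  "det3 (circle_point k a) (circle_point k b) (circle_point k c) = 4 * sqrt (1 + k) * (sn k (b - a) * sn k (c - b) * sn k (c - a))"
proof -
  define w where "w = sqrt (1 + k)"
  show ?thesis
    unfolding det3_expand circle_point_nth w_def[symmetric] sn_diff
    using cs_square[of k a] cs_square[of k b] cs_square[of k c]
    by algebra
qed

text \<open>The circle belongs to \<open>u = (sqrt (1 + k), 0, 1)\<close> and \<open>p = sqrt (1 + k)\<close>; since
  \<open>\<langle>u, u\<rangle> = k\<close>, the sign of \<open>k\<close> decides its type.\<close>

lemma circle_point_hyp_circle:
  assumes k: "k > -1"
  shows "\<exists>C. hyp_circle C \<and> (\<forall>a. proj (circle_point k a) \<in> C)"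
proof -
  define w where "w = sqrt (1 + k)"
  have w: "w > 0" "w * w = 1 + k" using k by (auto simp: w_def)
  define u :: "real^3" where "u = vector [w, 0, 1]"
  have u: "u $ 1 = w" "u $ 2 = 0" "u $ 3 = 1" by (simp_all add: u_def vector_3)
  have uu: "lform u u = k" using w by (simp add: lform_def u)
  have "u \<noteq> 0" using u(3) by (metis zero_index zero_neq_one)
  moreover have "w > lnorm u" if "k > 0" using that by (simp add: lnorm_def uu w_def)
  ultimately have "hyp_circle {X \<in> hyp_plane. lform u (npoint_vec X) = w}"
    unfolding hyp_circle_def using w uu u
    by (intro exI[of _ u] exI[of _ w]) (cases k "0::real" rule: linorder_cases, auto)
  moreover have "lform u (circle_point k a) = w" for a
    by (simp add: lform_def u w_def algebra_simps)
  ultimately show ?thesis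
    using proj_hyperboloid[OF circle_point_hyperboloid, of k] k
    by (intro exI[of _ "{X \<in> hyp_plane. lform u (npoint_vec X) = w}"]) auto
qed

text \<open>The equation of the plane and \<open>\<langle>y, y\<rangle> = 1\<close> give \<open>y\<^sub>0 = 1 + 2 t\<close>, \<open>y\<^sub>2 = 2 sqrt (1 + k) t\<close>
  and \<open>y\<^sub>1\<^sup>2 = 4 t (1 - k t)\<close>; so \<open>y\<^sub>1 = +- 2 s c\<close> for the principal parameter with
  \<open>s = sqrt t\<close>, and the sign is corrected by a reflection of the parameter.\<close>

lemma circle_point_exists:
  assumes k: "k > -1" and y: "y \<in> hyperboloid" and pl: "sqrt (1 + k) * (y $ 1 - 1) = y $ 3"
  shows "\<exists>a. circle_point k a = y \<and> (k > 0 \<longrightarrow> 0 \<le> a \<and> sqrt k * a < pi)"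
proof -
  define w where "w = sqrt (1 + k)"
  have w: "w > 0" "w * w = 1 + k" using k by (auto simp: w_def)
  define t where "t = (y $ 1 - 1) / 2"
  have y13: "y $ 1 = 1 + 2 * t" "y $ 3 = 2 * w * t" using pl by (simp_all add: t_def w_def field_simps)
  have y2: "(y $ 2)\<^sup>2 = 4 * (t * (1 - k * t))"
    using y w(2) y13 unfolding hyperboloid_def lform_def mem_Collect_eq by algebra
  have one: "axis 1 1 \<in> hyperboloid" by (simp add: hyperboloid_def lform_def axis_def)
  have t0: "t \<ge> 0" using lform_hyperboloid_ge_1[OF y one] by (simp add: t_def lform_def axis_def)
  have kt: "k * t \<le> 1"
  proof (rule ccontr)
    assume h: "\<not> k * t \<le> 1"
    then have "t > 0" using t0 by (cases "t = 0") auto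
    then have "t * (1 - k * t) < 0" using h by (intro mult_pos_neg) auto
    then show False using y2 zero_le_power2[of "y $ 2"] by linarith
  qed
  define b where "b = arcsn k (sqrt t)"
  have b: "sn k b = sqrt t" "principal k b" using arcsn[of "sqrt t" k] t0 kt by (auto simp: b_def)
  have c: "(cs k b)\<^sup>2 = 1 - k * t" "cs k b \<ge> 0" using b t0 cs_nonneg by (auto simp: cs_square)
  have "(2 * sn k b * cs k b)\<^sup>2 = (y $ 2)\<^sup>2"
    using c b t0 y2 by (simp add: power_mult_distrib)
  then have y2': "y $ 2 = 2 * sn k b * cs k b \<or> y $ 2 = - (2 * sn k b * cs k b)"
    by (metis power2_eq_iff)
  have eq: "circle_point k a = y" if "sn k a * cs k a * 2 = y $ 2" "(sn k a)\<^sup>2 = t" for a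
    using that y13 by (simp add: vec_eq_iff forall_3 w_def)
  consider "y $ 2 = 2 * sn k b * cs k b" | "y $ 2 = - (2 * sn k b * cs k b)" "b \<noteq> 0"
    using y2' by (cases "b = 0") auto
  then show ?thesis
  proof cases
    case 1
    then have "circle_point k b = y" using b t0 by (intro eq) auto
    then show ?thesis using b(2) principal_less_pi by (auto simp: principal_def)
  next
    case 2
    \<comment> \<open>For \<open>k > 0\<close> the reflection is shifted by a turn to keep the parameter nonnegative.\<close>
    show ?thesis
    proof (cases "k > 0")
      case True
      have "cs k (pi / sqrt k - b) = - cs k b" using True by (simp add: cs_def right_diff_distrib)
      then have "circle_point k (pi / sqrt k - b) = y"
        using 2 b t0 sn_half_turn[OF True] by (intro eq) auto
      moreover have "sqrt k * b \<le> pi" "b > 0"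
        using principal_less_pi[OF b(2) True] b(2) 2 by (auto simp: principal_def)
      ultimately show ?thesis using True
        by (intro exI[of _ "pi / sqrt k - b"]) (auto simp: right_diff_distrib pos_le_divide_eq mult.commute)
    next
      case False
      then show ?thesis using 2 b t0 eq[of "- b"] by (intro exI[of _ "- b"]) auto
    qed
  qed
qed

lemma det3_matrix: "det3 (A *v x) (A *v y) (A *v z) = det A * det3 x y z"
  unfolding det3_expand det_3 matrix_vector_mult_def by (simp add: sum_3) algebra

text \<open>The vector that represents the determinant with two given rows in terms of the Lorentz form,
  and is therefore orthogonal to both.\<close>

definition lcross :: "real^3 \<Rightarrow> real^3 \<Rightarrow> real^3" where
  "lcross x y = vector [x $ 2 * y $ 3 - x $ 3 * y $ 2, x $ 1 * y $ 3 - x $ 3 * y $ 1, x $ 2 * y $ 1 - x $ 1 * y $ 2]"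

lemma lform_lcross: "lform (lcross x y) z = det3 x y z"
  by (simp add: lcross_def lform_def det3_expand vector_3 algebra_simps)

lemma lform_lcross_lcross: "lform (lcross x y) (lcross x y) = lform x x * lform y y - (lform x y)\<^sup>2"
  unfolding lcross_def lform_def vector_3 by algebra

lemma lorentz_frame:
  assumes "a \<in> hyperboloid" "lform v v = - 1" "lform a v = 0"
  obtains A where "lorentz A" "det A = 1" "\<And>x. A *v x = x $ 1 *\<^sub>R a + x $ 2 *\<^sub>R lcross a v + x $ 3 *\<^sub>R v"
proof
  let ?A = "cols3 a (lcross a v) v"
  have a: "lform a a = 1" using assms by (simp add: hyperboloid_def)
  have c: "lform (lcross a v) (lcross a v) = - 1" using assms a by (simp add: lform_lcross_lcross)
  have o: "lform (lcross a v) a = 0" "lform (lcross a v) v = 0"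
    by (simp_all add: lform_lcross det3_expand)
  show "lorentz ?A" using assms c o by (intro lorentz_cols3) (simp_all add: lform_commute)
  have "det3 a (lcross a v) v = - det3 a v (lcross a v)" by (simp add: det3_expand)
  then show "det ?A = 1" using c by (simp add: det_cols3 lform_lcross)
qed (simp add: cols3_mult)

text \<open>In all three cases \<open>\<langle>u, u\<rangle> < p\<^sup>2\<close>. Dividing \<open>u\<close> by \<open>+- sqrt (p\<^sup>2 - \<langle>u, u\<rangle>)\<close>, with the
  sign of \<open>p\<close>, turns the pair into one with \<open>p\<^sup>2 = 1 + \<langle>u, u\<rangle>\<close>.\<close>

lemma hyp_circle_normalized:
  assumes "hyp_circle C"
  obtains k u where "k > -1" "lform u u = k" "\<And>X. X \<in> C \<Longrightarrow> lform u (npoint_vec X) = sqrt (1 + k)"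
proof -
  obtain u p where u: "p \<noteq> 0" "lform u u > 0 \<and> u $ 1 > 0 \<and> p > lnorm u \<or>
         lform u u < 0 \<or> lform u u = 0 \<and> u $ 1 > 0 \<and> p > 0"
      "C = {X \<in> hyp_plane. lform u (npoint_vec X) = p}"
    using assms unfolding hyp_circle_def by blast
  have pq: "p\<^sup>2 > lform u u"
  proof -
    have "lform u u < p\<^sup>2" if "lform u u > 0" "p > lnorm u"
    proof -
      have "(lnorm u)\<^sup>2 < p\<^sup>2" using that by (intro power_strict_mono) (auto simp: lnorm_def)
      then show ?thesis using that by (simp add: lnorm_def)
    qed
    moreover have "p\<^sup>2 > 0" using u(1) by simp
    ultimately show ?thesis using u(2) by (auto intro: order.strict_trans)
  qed
  define r where "r = sqrt (p\<^sup>2 - lform u u)"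
  have r: "r > 0" "r\<^sup>2 = p\<^sup>2 - lform u u" using pq by (auto simp: r_def)
  define k where "k = lform u u / r\<^sup>2"
  have k1: "1 + k = (p / r)\<^sup>2" using r by (simp add: k_def power_divide field_simps)
  show thesis
  proof
    have "(p / r)\<^sup>2 > 0" using u(1) r by simp
    then show "k > -1" using k1 by linarith
    show "lform ((sgn p / r) *\<^sub>R u) ((sgn p / r) *\<^sub>R u) = k"
      using u(1) by (simp add: lform_scaleR k_def power2_eq_square sgn_if)
    show "lform ((sgn p / r) *\<^sub>R u) (npoint_vec X) = sqrt (1 + k)" if "X \<in> C" for X
      using that u(3) r by (simp add: lform_scaleR_left k1 abs_sgn mult.commute)
  qed
qed

section \<open>Polygons on the normal circle\<close>

lemma inscribed_sn_diff_pos: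
  assumes "inscribed k N s \<alpha>" "i < j" "j \<le> N"
  shows "sn k (\<alpha> j - \<alpha> i) > 0"
proof (rule sn_pos)
  show "\<alpha> j - \<alpha> i > 0" using inscribed_mono[OF assms] by simp
  have "\<alpha> i \<ge> 0" "\<alpha> j \<le> \<alpha> N"
    using inscribed_mono[OF assms(1), of 0 i] inscribed_mono[OF assms(1), of j N] assms
    by (cases "i = 0"; cases "j = N"; auto simp: inscribed_def)+
  then have "\<alpha> j - \<alpha> i \<le> \<alpha> N" by simp
  moreover assume k: "k > 0"
  ultimately have "sqrt k * (\<alpha> j - \<alpha> i) \<le> sqrt k * \<alpha> N" by (intro mult_left_mono) auto
  also have "\<dots> < pi" using assms(1) k by (simp add: inscribed_def)
  finally show "sqrt k * (\<alpha> j - \<alpha> i) < pi" .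
qed

lemma sn_diff_neg: "sn k (a - b) > 0 \<Longrightarrow> sn k (b - a) < 0"
  using sn_minus[of k "a - b"] by simp

text \<open>Either none of the three sines is negative or two of them are: vertex \<open>j\<close> comes before
  both ends of an ordinary side or after both, and between the ends of the closing side, which is
  traversed backwards.\<close>

lemma inscribed_convex:
  assumes i: "inscribed k N s \<alpha>" and N: "i < Suc N" "j < Suc N" "j \<noteq> i" "j \<noteq> Suc i mod Suc N"
  defines "i' \<equiv> Suc i mod Suc N"
  shows "sn k (\<alpha> i' - \<alpha> i) * sn k (\<alpha> j - \<alpha> i') * sn k (\<alpha> j - \<alpha> i) > 0"
proof (cases "i = N")
  case True
  then have "i' = 0" "0 < j" "j < N" using N by (auto simp: i'_def)
  then show ?thesis using True
    inscribed_sn_diff_pos[OF i, of 0 N] inscribed_sn_diff_pos[OF i, of 0 j] inscribed_sn_diff_pos[OF i, of j N]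
    by (simp add: sn_diff_neg mult_neg_pos mult_neg_neg)
next
  case False
  then have i': "i' = Suc i" "i < N" using N by (auto simp: i'_def)
  note p = inscribed_sn_diff_pos[OF i, of i "Suc i"]
  consider "j < i" | "j > Suc i" using N i' by (fastforce simp: i'_def)
  then show ?thesis
  proof cases
    case 1
    then show ?thesis using p i' inscribed_sn_diff_pos[OF i, of j i] inscribed_sn_diff_pos[OF i, of j "Suc i"]
      by (simp add: sn_diff_neg mult_pos_neg mult_neg_neg)
  next
    case 2
    then show ?thesis using p i' N inscribed_sn_diff_pos[OF i, of i j] inscribed_sn_diff_pos[OF i, of "Suc i" j]
      by simp
  qed
qed

definition circle_polygon :: "real \<Rightarrow> nat \<Rightarrow> (nat \<Rightarrow> real) \<Rightarrow> (real^2) list" where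
  "circle_polygon k N \<alpha> = map (\<lambda>j. proj (circle_point k (\<alpha> j))) [0..<Suc N]"

lemma circle_polygon_nth: "j < Suc N \<Longrightarrow> circle_polygon k N \<alpha> ! j = proj (circle_point k (\<alpha> j))"
  and length_circle_polygon: "length (circle_polygon k N \<alpha>) = Suc N"
  by (simp_all add: circle_polygon_def nth_append del: upt_Suc)

lemma hyp_dist_circle_point:
  assumes "k \<ge> -1" "t \<ge> 0" "(sn k (a - b))\<^sup>2 = (sinh (t / 2))\<^sup>2"
  shows "hyp_dist (proj (circle_point k a)) (proj (circle_point k b)) = t"
proof -
  have "cosh (2 * (t / 2)) = 1 + 2 * (sinh (t / 2))\<^sup>2"
    unfolding cosh_double using cosh_square_eq[of "t / 2"] by simp
  then show ?thesis
    using assms by (simp add: hyp_dist_eq_iff_lform circle_point_hyperboloid lform_circle_point)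
qed

lemma circle_polygon_properties:
  assumes k: "k > -1" and N: "N \<ge> 2" and L: "length L = Suc N" "\<And>i. i \<le> N \<Longrightarrow> L ! i > 0"
    and i: "inscribed k N (\<lambda>i. sinh (L ! i / 2)) \<alpha>"
  defines "Z \<equiv> circle_polygon k N \<alpha>"
  shows "ngon (Suc N) Z" "oriented_convex Z" "cocyclic_polygon Z" "sidelengths Z = L"
proof -
  have Z: "Z ! j = proj (circle_point k (\<alpha> j))" if "j < Suc N" for j
    using that by (simp add: Z_def circle_polygon_nth)
  have len: "length Z = Suc N" by (simp add: Z_def length_circle_polygon)
  have H: "circle_point k a \<in> hyperboloid" for a using circle_point_hyperboloid k by simp
  have chord: "(sn k (\<alpha> j - \<alpha> (Suc j mod Suc N)))\<^sup>2 = (sinh (L ! j / 2))\<^sup>2" if "j < Suc N" for j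
  proof (cases "j = N")
    case True
    then show ?thesis using i by (simp add: inscribed_def)
  next
    case False
    then have "sn k (\<alpha> (Suc j) - \<alpha> j) = sinh (L ! j / 2)" "Suc j mod Suc N = Suc j"
      using that i by (auto simp: inscribed_def)
    then show ?thesis using sn_minus[of k "\<alpha> (Suc j) - \<alpha> j"] by simp
  qed
  have d: "hyp_dist (Z ! j) (Z ! (Suc j mod Suc N)) = L ! j" if "j < Suc N" for j
    using hyp_dist_circle_point[OF _ _ chord[OF that], OF _ less_imp_le[OF L(2)]] k that
    by (simp add: Z)
  have "hyp_dist X X = 0" if "X \<in> hyp_plane" for X
  proof -
    have "hyp_dist (proj (npoint_vec X)) (proj (npoint_vec X)) = 0"
      using npoint_vec_hyperboloid(1)[OF that]
      by (simp add: hyp_dist_proj) (simp add: hyperboloid_def)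
    then show ?thesis by (simp add: npoint_vec_hyperboloid(2)[OF that])
  qed
  moreover have sub: "Z ! j \<in> hyp_plane" if "j < Suc N" for j
    using proj_hyperboloid(1)[OF H] Z that by simp
  ultimately have "Z ! j \<noteq> Z ! (Suc j mod Suc N)" if "j < Suc N" for j
    using d[OF that] L(2)[of j] that by (metis less_Suc_eq_le less_irrefl mod_less_divisor zero_less_Suc)
  then show "ngon (Suc N) Z"
    using N len sub by (auto simp: ngon_def in_set_conv_nth)
  show "sidelengths Z = L"
    by (rule nth_equalityI) (simp_all add: sidelengths_def len L d del: upt_Suc)
  show "oriented_convex Z"
    unfolding oriented_convex_def len
  proof (intro allI impI)
    fix i' j assume ij: "i' < Suc N" "j < Suc N" "j \<noteq> i' \<and> j \<noteq> Suc i' mod Suc N"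
    then have "sn k (\<alpha> (Suc i' mod Suc N) - \<alpha> i') * sn k (\<alpha> j - \<alpha> (Suc i' mod Suc N)) * sn k (\<alpha> j - \<alpha> i') > 0"
      using inscribed_convex[OF i] by blast
    moreover have "sqrt (1 + k) > 0" using k by simp
    ultimately show "det3 (point_vec (Z ! i')) (point_vec (Z ! (Suc i' mod Suc N))) (point_vec (Z ! j)) > 0"
      using ij by (simp add: Z det3_proj_pos_iff H det3_circle_point)
  qed
  obtain C where "hyp_circle C" "\<And>a. proj (circle_point k a) \<in> C" using circle_point_hyp_circle[OF k] by blast
  then show "cocyclic_polygon Z"
    by (auto simp: cocyclic_polygon_def Z_def circle_polygon_def)
qed

section \<open>Normal form of a convex cocyclic polygon\<close>

text \<open>The determinants that involve the first vertex order the parameters. For \<open>k > 0\<close> the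
  parameters can be chosen in one turn from the first vertex, so all sines of parameters are
  positive and the middle factor of \<open>conv\<close> gives monotonicity. For \<open>k \<le> 0\<close> the circle is not
  closed, and the order might jump from the top to the bottom at some side other than the last. Such
  a side would span all the other vertices and hence be longer than the last one.\<close>

lemma convex_parameters_inscribed:
  assumes N: "N \<ge> 2" and a0: "\<alpha> 0 = 0"
    and turn: "\<And>j. k > 0 \<Longrightarrow> j \<le> N \<Longrightarrow> 0 \<le> \<alpha> j \<and> sqrt k * \<alpha> j < pi"
    and conv: "\<And>i. 1 \<le> i \<Longrightarrow> i < N \<Longrightarrow> sn k (\<alpha> i) * sn k (\<alpha> (Suc i) - \<alpha> i) * sn k (\<alpha> (Suc i)) > 0"
    and len: "\<And>i. i < N \<Longrightarrow> \<bar>sn k (\<alpha> (Suc i) - \<alpha> i)\<bar> = s i" "\<bar>sn k (\<alpha> N)\<bar> = s N"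
    and le: "\<And>i. i < N \<Longrightarrow> s i \<le> s N"
  shows "inscribed k N s \<alpha>"
proof -
  have sgn: "sn k x > 0" if "x > 0" "k \<le> 0" for x using sn_pos[of x k] that by auto
  have sgn': "sn k x < 0" if "x < 0" "k \<le> 0" for x using sgn[of "- x"] that by simp
  have nz: "\<alpha> j \<noteq> 0" if "1 \<le> j" "j \<le> N" for j
  proof (cases "j = N")
    case True
    then have "Suc (j - 1) = j" "1 \<le> j - 1" "j - 1 < N" using N by auto
    then show ?thesis using conv[of "j - 1"] by auto
  next
    case False
    then show ?thesis using conv[of j] that by auto
  qed
  have inc: "\<alpha> i < \<alpha> (Suc i)" if i: "1 \<le> i" "i < N" and p: "\<alpha> i > 0" "\<alpha> (Suc i) > 0" for i
  proof (rule ccontr)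
    assume "\<not> ?thesis"
    then have "\<alpha> i - \<alpha> (Suc i) \<ge> 0" by simp
    have "sn k (\<alpha> i) > 0" "sn k (\<alpha> (Suc i)) > 0"
      using turn[of i] turn[of "Suc i"] i p by (auto intro!: sn_pos)
    then have c: "sn k (\<alpha> (Suc i) - \<alpha> i) > 0"
      using conv[OF i] by (simp add: zero_less_mult_iff)
    then have "\<alpha> i \<noteq> \<alpha> (Suc i)" by auto
    then have "sn k (\<alpha> i - \<alpha> (Suc i)) > 0"
    proof (intro sn_pos)
      assume k: "k > 0"
      have "sqrt k * (\<alpha> i - \<alpha> (Suc i)) \<le> sqrt k * \<alpha> i" using k p by simp
      then show "sqrt k * (\<alpha> i - \<alpha> (Suc i)) < pi" using turn[OF k, of i] i by simp
    qed (use \<open>\<alpha> i - \<alpha> (Suc i) \<ge> 0\<close> in simp)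
    then show False using sn_diff_neg c by fastforce
  qed
  have pos: "\<alpha> j > 0" if "1 \<le> j" "j \<le> N" for j
  proof (cases "k > 0")
    case True
    then show ?thesis using turn[OF True that(2)] nz[OF that] by simp
  next
    case False
    then have k: "k \<le> 0" by simp
    have mono: "sn k x < sn k y" if "0 \<le> x" "x < y" for x y
      using sn_strict_mono[of k y x] that k by (simp add: principal_def)
    \<comment> \<open>A negative parameter is followed by negative, not smaller ones only.\<close>
    have stay: "\<alpha> j \<le> \<alpha> i \<and> \<alpha> i < 0" if "\<alpha> j < 0" "1 \<le> j" "j \<le> i" "i \<le> N" for i j
      using that(3,4)
    proof (induction i rule: dec_induct)
      case (step i)
      then have i: "\<alpha> j \<le> \<alpha> i" "\<alpha> i < 0" "1 \<le> i" "i < N" using that by auto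
      have c: "sn k (\<alpha> (Suc i) - \<alpha> i) * sn k (\<alpha> (Suc i)) < 0"
        using conv[OF i(3,4)] sgn'[OF i(2) k] by (simp add: mult.assoc zero_less_mult_iff)
      have "\<not> \<alpha> (Suc i) > 0"
      proof
        assume "\<alpha> (Suc i) > 0"
        then have "sn k (\<alpha> (Suc i) - \<alpha> i) * sn k (\<alpha> (Suc i)) > 0" using i k sgn by simp
        then show False using c by simp
      qed
      then have n: "\<alpha> (Suc i) < 0" using nz[of "Suc i"] i by force
      have "\<not> \<alpha> (Suc i) < \<alpha> i"
      proof
        assume "\<alpha> (Suc i) < \<alpha> i"
        then have "sn k (\<alpha> (Suc i) - \<alpha> i) * sn k (\<alpha> (Suc i)) > 0"
          using n k sgn' by (simp add: mult_neg_neg)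
        then show False using c by simp
      qed
      then show ?case using i n by simp
    qed (use that in simp)
    show ?thesis
    proof (rule ccontr)
      assume "\<not> ?thesis"
      then have "\<alpha> j < 0" using nz[OF that] by simp
      then have ex: "1 \<le> j \<and> \<alpha> j < 0" using that by simp
      \<comment> \<open>The side from \<open>m - 1\<close> to \<open>m\<close> jumps over the first vertex.\<close>
      define m where "m = (LEAST j. 1 \<le> j \<and> \<alpha> j < 0)"
      have m: "1 \<le> m" "\<alpha> m < 0" using LeastI[of "\<lambda>j. 1 \<le> j \<and> \<alpha> j < 0", OF ex] by (auto simp: m_def)
      have mj: "m \<le> j" unfolding m_def using ex by (rule Least_le)
      then have mN: "m \<le> N" using that by simp
      have N': "\<alpha> m \<le> \<alpha> N" "\<alpha> N < 0" using stay[OF m(2,1) mN] by auto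
      obtain l where l: "m = Suc l" using m(1) by (cases m) auto
      have "\<not> (1 \<le> l \<and> \<alpha> l < 0)" using not_less_Least[of l "\<lambda>j. 1 \<le> j \<and> \<alpha> j < 0"] l by (simp add: m_def)
      then have l0: "\<alpha> l \<ge> 0" "l \<ge> 1 \<Longrightarrow> \<alpha> l > 0"
        using a0 nz[of l] l mN by (cases l; force)+
      have "sn k (\<alpha> l - \<alpha> m) \<le> sn k (- \<alpha> N)"
      proof -
        have "\<bar>sn k (\<alpha> m - \<alpha> l)\<bar> \<le> \<bar>sn k (\<alpha> N)\<bar>" using len(1)[of l] len(2) le[of l] l mN by simp
        moreover have "sn k (\<alpha> m - \<alpha> l) < 0" "sn k (\<alpha> N) < 0" using N' m l0 k sgn' by auto
        moreover have "sn k (\<alpha> l - \<alpha> m) = - sn k (\<alpha> m - \<alpha> l)" using sn_minus[of k "\<alpha> m - \<alpha> l"] by simp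
        ultimately show ?thesis by simp
      qed
      then have "\<alpha> l - \<alpha> m \<le> - \<alpha> N" using mono[of "- \<alpha> N" "\<alpha> l - \<alpha> m"] N' by force
      then have "\<alpha> l = 0" "\<alpha> m = \<alpha> N" using l0 N' by linarith+
      then have "\<alpha> 1 = \<alpha> N" using l0 l by (cases l) auto
      have a1: "\<alpha> 1 < 0" using \<open>\<alpha> 1 = \<alpha> N\<close> N' by simp
      have c1: "\<alpha> 1 \<le> \<alpha> 2" "\<alpha> 2 \<le> \<alpha> N" using stay[of 1 2] stay[of 2 N] a1 N by force+
      then have "\<alpha> 2 = \<alpha> 1" using \<open>\<alpha> 1 = \<alpha> N\<close> by simp
      then show False using conv[of 1] N by (simp add: numeral_2_eq_2)
    qed
  qed
  have inc': "\<alpha> i < \<alpha> (Suc i)" if "i < N" for i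
    using inc[of i] pos[of i] pos[of "Suc i"] a0 that by (cases "i = 0") auto
  have ge0: "\<alpha> i \<ge> 0" if "i \<le> N" for i using pos[of i] a0 that by (cases "i = 0") auto
  have "sn k (\<alpha> (Suc i) - \<alpha> i) > 0" if "i < N" for i
  proof (rule sn_pos)
    assume k: "k > 0"
    have "sqrt k * (\<alpha> (Suc i) - \<alpha> i) \<le> sqrt k * \<alpha> (Suc i)" using k ge0[of i] that by simp
    then show "sqrt k * (\<alpha> (Suc i) - \<alpha> i) < pi" using turn[OF k, of "Suc i"] that by simp
  qed (use inc'[OF that] in simp)
  moreover have "sn k (\<alpha> N) > 0" using turn[of N] pos[of N] N by (intro sn_pos) auto
  ultimately show ?thesis
    using a0 inc' turn[of N] len by (force simp: inscribed_def)
qed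

text \<open>With \<open>u\<close> normalized, \<open>v = u - sqrt (1 + k) z\<^sub>0\<close> is orthogonal to the first vertex
  \<open>z\<^sub>0\<close> and satisfies \<open>\<langle>v, v\<rangle> = -1\<close>. The frame \<open>z\<^sub>0, z\<^sub>0 \<times> v, v\<close> carries the normal
  circle with invariant \<open>k\<close>, with its point \<open>(1, 0, 0)\<close>, to the given circle with
  \<open>z\<^sub>0\<close>, and preserves orientation.\<close>

lemma convex_cocyclic_normal_form:
  assumes Z: "ngon (Suc N) Z" "oriented_convex Z" "cocyclic_polygon Z" and N: "N \<ge> 2"
    and max: "\<And>i. i < N \<Longrightarrow> sidelengths Z ! i \<le> sidelengths Z ! N"
  obtains k \<alpha> A where "k > -1" "inscribed k N (\<lambda>i. sinh (sidelengths Z ! i / 2)) \<alpha>"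
    "lorentz A" "det A = 1" "Z = map (lorentz_map A) (circle_polygon k N \<alpha>)"
proof -
  have len: "length Z = Suc N" and sub: "\<And>j. j < Suc N \<Longrightarrow> Z ! j \<in> hyp_plane"
    using Z(1) by (auto simp: ngon_def)
  define z where "z j = npoint_vec (Z ! j)" for j
  have z: "z j \<in> hyperboloid" "proj (z j) = Z ! j" if "j < Suc N" for j
    using npoint_vec_hyperboloid[OF sub[OF that]] by (auto simp: z_def)
  obtain C where "hyp_circle C" "set Z \<subseteq> C" using Z(3) by (auto simp: cocyclic_polygon_def)
  then obtain k u where k: "k > -1" and u: "lform u u = k" "\<And>j. j < Suc N \<Longrightarrow> lform u (z j) = sqrt (1 + k)"
    by (metis hyp_circle_normalized len nth_mem subsetD z_def)
  define w where "w = sqrt (1 + k)"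
  have w: "w > 0" "w * w = 1 + k" using k by (auto simp: w_def)
  define v where "v = u - w *\<^sub>R z 0"
  have z0: "lform (z 0) (z 0) = 1" using z(1)[of 0] by (simp add: hyperboloid_def)
  have uz: "lform u (z 0) = w" "lform (z 0) u = w" using u(2)[of 0] by (auto simp: w_def lform_commute)
  have "lform v v = - 1" "lform (z 0) v = 0"
    using w u(1) by (simp_all add: v_def lform_bilinear z0 uz)
  then obtain A where A: "lorentz A" "det A = 1"
      "\<And>x. A *v x = x $ 1 *\<^sub>R z 0 + x $ 2 *\<^sub>R lcross (z 0) v + x $ 3 *\<^sub>R v"
    using lorentz_frame[OF z(1)] by (metis zero_less_Suc)
  obtain B where B: "lorentz B" "B ** A = mat 1" "A ** B = mat 1" using lorentz_inverse[OF A(1)] by blast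
  define y where "y j = B *v z j" for j
  have Ay: "A *v y j = z j" for j by (simp add: y_def matrix_vector_mul_assoc B)
  have y: "y j \<in> hyperboloid" if "j < Suc N" for j
    using lorentz_hyperboloid[OF B(1) z(1)[OF that]] by (simp add: y_def)
  have yl: "lform (y i) (y j) = lform (z i) (z j)" for i j by (simp add: y_def lorentz_lform[OF B(1)])
  have det: "det3 (z a) (z b) (z c) = det3 (y a) (y b) (y c)" for a b c
    using det3_matrix[of A "y a" "y b" "y c"] by (simp add: Ay A(2))
  define e where "e = (vector [w, 0, 1] :: real^3)"
  have Ae: "A *v e = u" by (simp add: A(3) e_def vector_3 v_def)
  have "lform e (y j) = w" if "j < Suc N" for j
    using lorentz_lform[OF A(1), of e "y j"] u(2)[OF that] by (simp add: Ay Ae w_def)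
  then have pl: "sqrt (1 + k) * (y j $ 1 - 1) = y j $ 3" if "j < Suc N" for j
    using that by (simp add: lform_def e_def vector_3 w_def algebra_simps)
  have "\<exists>a. circle_point k a = y j \<and> (k > 0 \<longrightarrow> 0 \<le> a \<and> sqrt k * a < pi)" if "j < Suc N" for j
    using circle_point_exists[OF k y[OF that] pl[OF that]] .
  then obtain \<alpha> where \<alpha>: "circle_point k (\<alpha> j) = y j" "k > 0 \<Longrightarrow> 0 \<le> \<alpha> j \<and> sqrt k * \<alpha> j < pi" if "j < Suc N" for j
    by metis
  have "A *v axis 1 1 = z 0" by (simp add: A(3) axis_def)
  then have "y 0 = axis 1 1" unfolding y_def by (metis B(2) matrix_vector_mul_assoc matrix_vector_mul_lid)
  then have s0: "sn k (\<alpha> 0) = 0" using \<alpha>(1)[of 0] by (simp add: circle_point_def axis_def vec_eq_iff forall_3 vector_3)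
  have a0: "\<alpha> 0 = 0"
  proof (rule ccontr)
    assume "\<alpha> 0 \<noteq> 0"
    then consider "\<alpha> 0 > 0" | "\<alpha> 0 < 0" "k \<le> 0" using \<alpha>(2)[of 0] by force
    then show False
    proof cases
      case 1 then show False using sn_pos[of "\<alpha> 0" k] \<alpha>(2)[of 0] s0 by force
    next
      case 2 then show False using sn_pos[of "- \<alpha> 0" k] s0 by simp
    qed
  qed
  have sl: "sidelengths Z ! i = hyp_dist (Z ! i) (Z ! (Suc i mod Suc N))" if "i < Suc N" for i
    using that by (simp add: sidelengths_def len del: upt_Suc)
  have slp: "sidelengths Z ! i \<ge> 0"
      "\<bar>sn k (\<alpha> i - \<alpha> (Suc i mod Suc N))\<bar> = sinh (sidelengths Z ! i / 2)" if i: "i < Suc N" for i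
  proof -
    have i': "Suc i mod Suc N < Suc N" by simp
    show g: "sidelengths Z ! i \<ge> 0"
      using cosh_hyp_dist_proj(2)[OF z(1)[OF i] z(1)[OF i']] z(2)[OF i] z(2)[OF i'] sl[OF i] by simp
    have "1 + 2 * (sn k (\<alpha> i - \<alpha> (Suc i mod Suc N)))\<^sup>2 = 1 + 2 * (sinh (sidelengths Z ! i / 2))\<^sup>2"
      using lform_eq_sinh_half[OF z(1)[OF i] z(1)[OF i']] z(2)[OF i] z(2)[OF i'] sl[OF i]
        lform_circle_point[of k "\<alpha> i" "\<alpha> (Suc i mod Suc N)"] k \<alpha>(1)[OF i] \<alpha>(1)[OF i'] yl by simp
    then have "\<bar>sn k (\<alpha> i - \<alpha> (Suc i mod Suc N))\<bar> = \<bar>sinh (sidelengths Z ! i / 2)\<bar>"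
      by (simp add: power2_eq_iff abs_eq_iff)
    then show "\<bar>sn k (\<alpha> i - \<alpha> (Suc i mod Suc N))\<bar> = sinh (sidelengths Z ! i / 2)" using g by simp
  qed
  have "inscribed k N (\<lambda>i. sinh (sidelengths Z ! i / 2)) \<alpha>"
  proof (rule convex_parameters_inscribed[where \<alpha> = \<alpha>, OF N a0])
    show "0 \<le> \<alpha> j \<and> sqrt k * \<alpha> j < pi" if "k > 0" "j \<le> N" for j using \<alpha>(2)[of j] that by simp
    show "\<bar>sn k (\<alpha> (Suc i) - \<alpha> i)\<bar> = sinh (sidelengths Z ! i / 2)" if "i < N" for i
      using slp(2)[of i] that sn_minus[of k "\<alpha> i - \<alpha> (Suc i)"] by simp
    show "\<bar>sn k (\<alpha> N)\<bar> = sinh (sidelengths Z ! N / 2)" using slp(2)[of N] a0 by simp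
    show "sinh (sidelengths Z ! i / 2) \<le> sinh (sidelengths Z ! N / 2)" if "i < N" for i
      using max[OF that] by simp
    show "sn k (\<alpha> i) * sn k (\<alpha> (Suc i) - \<alpha> i) * sn k (\<alpha> (Suc i)) > 0" if i: "1 \<le> i" "i < N" for i
    proof -
      have "det3 (point_vec (Z ! i)) (point_vec (Z ! Suc i)) (point_vec (Z ! 0)) > 0"
        using Z(2) i N len unfolding oriented_convex_def by (elim allE[of _ i] impE allE[of _ 0]) auto
      then have "det3 (z i) (z (Suc i)) (z 0) > 0"
        using det3_proj_pos_iff[OF z(1) z(1) z(1), of i "Suc i" 0] z(2) i by simp
      also have "det3 (z i) (z (Suc i)) (z 0) = det3 (z 0) (z i) (z (Suc i))" by (simp add: det3_expand)
      also have "\<dots> = 4 * sqrt (1 + k) * (sn k (\<alpha> i) * sn k (\<alpha> (Suc i) - \<alpha> i) * sn k (\<alpha> (Suc i)))"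
        unfolding det using det3_circle_point[of k "\<alpha> 0" "\<alpha> i" "\<alpha> (Suc i)"]
          \<alpha>(1)[of 0] \<alpha>(1)[of i] \<alpha>(1)[of "Suc i"] i a0 by simp
      finally show ?thesis using w(1) unfolding w_def[symmetric] by (simp add: zero_less_mult_iff)
    qed
  qed
  moreover have "Z = map (lorentz_map A) (circle_polygon k N \<alpha>)"
    by (rule nth_equalityI)
      (simp_all add: len length_circle_polygon circle_polygon_nth lorentz_map_proj circle_point_hyperboloid less_imp_le[OF k] \<alpha> Ay y z)
  ultimately show thesis using that k A by blast
qed

section \<open>Existence and uniqueness when the longest side is the last\<close>

text \<open>Two images of one polygon under Lorentz maps \<open>A\<close> and \<open>B\<close> are related by \<open>B A\<^sup>-\<^sup>1\<close>; thus a
  normal form that depends only on the sidelengths gives uniqueness.\<close>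

lemma lorentz_map_change_frame:
  assumes A: "lorentz A" and B: "lorentz B"
  obtains C where "lorentz C" "det C * det A = det B"
    "\<And>X. X \<in> hyp_plane \<Longrightarrow> lorentz_map C (lorentz_map A X) = lorentz_map B X"
proof -
  obtain A' where A': "lorentz A'" "A' ** A = mat 1" using lorentz_inverse[OF A] by blast
  show thesis
  proof
    show "lorentz (B ** A')" using B A' by (simp add: lorentz_mult)
    have "det A' * det A = 1" using A'(2) by (metis det_I det_mul)
    then show "det (B ** A') * det A = det B" by (simp add: det_mul mult.assoc)
    fix X assume "X \<in> hyp_plane"
    then obtain x where x: "x \<in> hyperboloid" "X = proj x" by (auto simp: hyp_plane_eq_proj)
    have "A' *v (A *v x) = x" by (simp add: matrix_vector_mul_assoc A')
    then show "lorentz_map (B ** A') (lorentz_map A X) = lorentz_map B X"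
      using x lorentz_hyperboloid[OF A] by (simp add: lorentz_map_proj flip: matrix_vector_mul_assoc)
  qed
qed

lemma hyp_congruent_lorentz_map:
  assumes "lorentz A" "lorentz B" "set Z \<subseteq> hyp_plane"
  shows "hyp_congruent (map (lorentz_map A) Z) (map (lorentz_map B) Z)"
proof -
  obtain C where "lorentz C" "\<And>X. X \<in> hyp_plane \<Longrightarrow> lorentz_map C (lorentz_map A X) = lorentz_map B X"
    using lorentz_map_change_frame[OF assms(1,2)] by blast
  then show ?thesis using assms(3)
    unfolding hyp_congruent_def by (intro exI[of _ "lorentz_map C"]) (auto simp: hyp_isometry_lorentz_map)
qed

lemma hyp_equivalent_lorentz_map:
  assumes "lorentz A" "lorentz B" "det A > 0" "det B > 0" "set Z \<subseteq> hyp_plane"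
  shows "hyp_equivalent (map (lorentz_map A) Z) (map (lorentz_map B) Z)"
proof -
  obtain C where C: "lorentz C" "det C * det A = det B" "\<And>X. X \<in> hyp_plane \<Longrightarrow> lorentz_map C (lorentz_map A X) = lorentz_map B X"
    using lorentz_map_change_frame[OF assms(1,2)] by blast
  then have "det C > 0" using assms(3,4) by (metis zero_less_mult_pos2)
  then show ?thesis using assms(5) C
    unfolding hyp_equivalent_def by (intro exI[of _ "lorentz_map C"]) (auto simp: hyp_motion_lorentz_map)
qed

text \<open>Both polygons are images of the same polygon on the normal circle: its invariant and its
  parameters are determined by the sidelengths.\<close>

lemma convex_cocyclic_polygon_max_last:
  assumes N: "N \<ge> 2" and L: "length L = Suc N" "\<And>i. i \<le> N \<Longrightarrow> L ! i > 0"
    and max: "\<And>i. i < N \<Longrightarrow> L ! i \<le> L ! N" and less: "L ! N < (\<Sum>i<N. L ! i)"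
  shows "\<exists>Z. ngon (Suc N) Z \<and> oriented_convex Z \<and> cocyclic_polygon Z \<and> sidelengths Z = L"
    and "ngon (Suc N) Z \<Longrightarrow> oriented_convex Z \<Longrightarrow> cocyclic_polygon Z \<Longrightarrow> sidelengths Z = L \<Longrightarrow>
      ngon (Suc N) W \<Longrightarrow> oriented_convex W \<Longrightarrow> cocyclic_polygon W \<Longrightarrow> sidelengths W = L \<Longrightarrow>
      hyp_equivalent Z W"
proof -
  define s where "s i = sinh (L ! i / 2)" for i
  have s: "s i > 0" if "i \<le> N" for i using L(2)[OF that] by (simp add: s_def)
  have s': "s i \<le> s N" if "i < N" for i using max[OF that] by (simp add: s_def)
  have "arsinh (s N) < (\<Sum>i<N. arsinh (s i))"
    using less by (simp add: s_def arsinh_sinh_real flip: sum_divide_distrib)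
  then obtain k \<alpha> where "k > -1" "inscribed k N s \<alpha>"
    using inscribed_exists[of N s] N s s' by blast
  then show "\<exists>Z. ngon (Suc N) Z \<and> oriented_convex Z \<and> cocyclic_polygon Z \<and> sidelengths Z = L"
    using circle_polygon_properties[of k N L \<alpha>] N L unfolding s_def by blast
  assume Z: "ngon (Suc N) Z" "oriented_convex Z" "cocyclic_polygon Z" "sidelengths Z = L"
    and W: "ngon (Suc N) W" "oriented_convex W" "cocyclic_polygon W" "sidelengths W = L"
  obtain k \<alpha> A where A: "k > -1" "inscribed k N s \<alpha>" "lorentz A" "det A = 1"
      "Z = map (lorentz_map A) (circle_polygon k N \<alpha>)"
    using convex_cocyclic_normal_form[OF Z(1-3) N] max unfolding Z(4) s_def by blast
  obtain k' \<alpha>' B where B: "k' > -1" "inscribed k' N s \<alpha>'" "lorentz B" "det B = 1"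
      "W = map (lorentz_map B) (circle_polygon k' N \<alpha>')"
    using convex_cocyclic_normal_form[OF W(1-3) N] max unfolding W(4) s_def by blast
  have k': "k' = k" "\<And>j. j \<le> N \<Longrightarrow> \<alpha>' j = \<alpha> j"
    using inscribed_unique[OF A(2) B(2) N s s'] by blast+
  have "circle_polygon k' N \<alpha>' = circle_polygon k N \<alpha>"
    using k' by (auto simp: circle_polygon_def simp del: upt_Suc)
  moreover have "set (circle_polygon k N \<alpha>) \<subseteq> hyp_plane"
    using A(1) by (auto simp: circle_polygon_def intro!: proj_hyperboloid circle_point_hyperboloid)
  ultimately show "hyp_equivalent Z W"
    using hyp_equivalent_lorentz_map[of A B] A B by simp
qed

section \<open>Degenerate polygons\<close>

text \<open>With \<open>a, b, c\<close> for the three distances, nonnegativity of the Gram determinant reads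
  \<open>(cosh c - cosh a cosh b)\<^sup>2 \<le> sinh\<^sup>2 a sinh\<^sup>2 b\<close>, hence \<open>cosh c \<le> cosh (a + b)\<close>.\<close>

lemma hyp_dist_triangle:
  assumes "X \<in> hyp_plane" "Y \<in> hyp_plane" "Z \<in> hyp_plane"
  shows "hyp_dist X Z \<le> hyp_dist X Y + hyp_dist Y Z"
proof -
  obtain x y z where xyz: "x \<in> hyperboloid" "y \<in> hyperboloid" "z \<in> hyperboloid"
      "X = proj x" "Y = proj y" "Z = proj z"
    using assms by (auto simp: hyp_plane_eq_proj)
  define a b c where "a = hyp_dist X Y" "b = hyp_dist Y Z" "c = hyp_dist X Z"
  note abc = this
  have h: "cosh a = lform x y" "cosh b = lform y z" "cosh c = lform x z" "a \<ge> 0" "b \<ge> 0"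
    using cosh_hyp_dist_proj xyz by (auto simp: abc)
  have "(det3 x y z)\<^sup>2 \<ge> 0" by simp
  then have "(cosh c - cosh a * cosh b)\<^sup>2 \<le> ((cosh a)\<^sup>2 - 1) * ((cosh b)\<^sup>2 - 1)"
    using xyz(1-3) unfolding gram_det3 h hyperboloid_def by (simp add: algebra_simps power2_eq_square)
  also have "\<dots> = (sinh a * sinh b)\<^sup>2" by (simp add: sinh_square_eq power_mult_distrib)
  finally have "cosh c - cosh a * cosh b \<le> sinh a * sinh b"
    by (rule power2_le_imp_le) (use h in simp)
  then have "cosh c \<le> cosh (a + b)" by (simp add: cosh_add)
  moreover have "cosh (a + b) < cosh c" if "a + b < c"
    using cosh_real_strict_mono[of "a + b" c] that h by simp
  ultimately show ?thesis by (force simp: abc[symmetric])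
qed

definition axis_point :: "real \<Rightarrow> real^3" where "axis_point t = vector [cosh t, sinh t, 0]"

lemma axis_point_nth [simp]: "axis_point t $ 1 = cosh t" "axis_point t $ 2 = sinh t" "axis_point t $ 3 = 0"
  by (simp_all add: axis_point_def vector_3)

lemma lform_axis_point: "lform (axis_point a) (axis_point b) = cosh (a - b)"
  by (simp add: lform_def cosh_diff)

lemma axis_point_hyperboloid: "axis_point a \<in> hyperboloid"
  by (simp add: hyperboloid_def lform_axis_point)

lemma hyp_dist_axis_point: "hyp_dist (proj (axis_point a)) (proj (axis_point b)) = \<bar>a - b\<bar>"
  by (simp add: hyp_dist_eq_iff_lform axis_point_hyperboloid lform_axis_point)

text \<open>The model polygon of the degenerate case; in the chord along the first axis its vertices
  lie at the distances \<open>L ! 0 + \<dots> + L ! (j - 1)\<close> from the origin.\<close>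

definition line_polygon :: "real list \<Rightarrow> (real^2) list" where
  "line_polygon L = map (\<lambda>j. proj (axis_point (\<Sum>i<j. L ! i))) [0..<length L]"

lemma sidelengths_nth:
  "i < length Z \<Longrightarrow> sidelengths Z ! i = hyp_dist (Z ! i) (Z ! (Suc i mod length Z))"
  and length_sidelengths: "length (sidelengths Z) = length Z"
  by (simp_all add: sidelengths_def)

lemma line_polygon_properties:
  assumes N: "N \<ge> 2" and L: "length L = Suc N" "\<And>i. i \<le> N \<Longrightarrow> L ! i > 0"
    and eq: "L ! N = (\<Sum>i<N. L ! i)"
  shows "ngon (Suc N) (line_polygon L)" "sidelengths (line_polygon L) = L"
proof -
  define Z where "Z = line_polygon L"
  have len: "length Z = Suc N" by (simp add: Z_def line_polygon_def L del: upt_Suc)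
  have Z: "Z ! j = proj (axis_point (\<Sum>i<j. L ! i))" if "j < Suc N" for j
    using that by (simp add: Z_def line_polygon_def L del: upt_Suc)
  have d: "hyp_dist (Z ! j) (Z ! (Suc j mod Suc N)) = L ! j" if "j < Suc N" for j
  proof (cases "j = N")
    case True
    then show ?thesis using L(2)[of N] eq by (simp add: Z hyp_dist_axis_point)
  next
    case False
    then show ?thesis using L(2)[of j] that by (simp add: Z hyp_dist_axis_point)
  qed
  show "sidelengths (line_polygon L) = L" unfolding Z_def[symmetric]
    by (rule nth_equalityI) (simp_all add: length_sidelengths len L sidelengths_nth d)
  have self: "hyp_dist (Z ! j) (Z ! j) = 0" if "j < Suc N" for j using that by (simp add: Z hyp_dist_axis_point)
  have "Z ! j \<noteq> Z ! (Suc j mod Suc N)" if "j < Suc N" for j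
    using d[OF that] self[OF that] L(2)[of j] that by auto
  moreover have "Z ! j \<in> hyp_plane" if "j < Suc N" for j
    using that by (simp add: Z proj_hyperboloid axis_point_hyperboloid)
  ultimately show "ngon (Suc N) (line_polygon L)" unfolding Z_def[symmetric]
    using N len by (auto simp: ngon_def in_set_conv_nth)
qed

text \<open>The triangle inequality along the chain of vertices bounds every distance from above; if one
  were strictly smaller, the first and the last vertex would be too close.\<close>

lemma degenerate_hyp_dist:
  assumes Z: "ngon (Suc N) Z" and eq: "sidelengths Z ! N = (\<Sum>i<N. sidelengths Z ! i)"
    and ij: "i \<le> j" "j \<le> N"
  shows "hyp_dist (Z ! i) (Z ! j) = (\<Sum>l<j. sidelengths Z ! l) - (\<Sum>l<i. sidelengths Z ! l)"
proof -
  have len: "length Z = Suc N" and sub: "\<And>j. j \<le> N \<Longrightarrow> Z ! j \<in> hyp_plane"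
    using Z by (auto simp: ngon_def subset_iff)
  define t where "t j = (\<Sum>l<j. sidelengths Z ! l)" for j
  have sym: "hyp_dist X Y = hyp_dist Y X" for X Y
    by (simp add: hyp_dist_def lform_commute mult.commute)
  have self: "hyp_dist X X = 0" if "X \<in> hyp_plane" for X
    using that by (auto simp: hyp_plane_eq_proj hyp_dist_proj hyperboloid_def)
  have up: "hyp_dist (Z ! i) (Z ! j) \<le> t j - t i" if "i \<le> j" "j \<le> N" for i j
    using that
  proof (induction j rule: dec_induct)
    case base
    then show ?case using self[OF sub, of i] by simp
  next
    case (step j)
    have "hyp_dist (Z ! j) (Z ! Suc j) = t (Suc j) - t j"
      using step by (simp add: t_def sidelengths_nth len)
    then show ?case
      using step hyp_dist_triangle[OF sub sub sub, of i j "Suc j"] by simp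
  qed
  have total: "hyp_dist (Z ! 0) (Z ! N) = t N - t 0"
    using eq sidelengths_nth[of N Z] by (simp add: t_def len sym)
  have "t N - t 0 \<le> t i - t 0 + hyp_dist (Z ! i) (Z ! j) + (t N - t j)"
    using hyp_dist_triangle[OF sub sub sub, of 0 i N] hyp_dist_triangle[OF sub sub sub, of i j N]
      up[of 0 i] up[of j N] ij unfolding total[symmetric] by simp
  then show ?thesis using up[OF ij] by (simp add: t_def)
qed

text \<open>In the frame with \<open>a = z\<^sub>0\<close> and \<open>b\<close> in the plane of \<open>z\<^sub>0\<close> and
  \<open>z\<^sub>N\<close>, the vector \<open>cosh t a + sinh t b\<close> has product \<open>cosh\<^sup>2 t - sinh\<^sup>2 t = 1\<close>
  with the vertex at distance \<open>t\<close> from \<open>z\<^sub>0\<close>, and product \<open>1\<close> means equality on the hyperboloid.\<close>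

lemma degenerate_normal_form:
  assumes N: "N \<ge> 2" and L: "length L = Suc N" "\<And>i. i \<le> N \<Longrightarrow> L ! i > 0"
    and eq: "L ! N = (\<Sum>i<N. L ! i)" and Z: "ngon (Suc N) Z" "sidelengths Z = L"
  obtains A where "lorentz A" "Z = map (lorentz_map A) (line_polygon L)"
proof -
  define t where "t j = (\<Sum>i<j. L ! i)" for j
  define D where "D = t N"
  have D: "D > 0" using eq L(2)[of N] by (simp add: D_def t_def)
  then have sD: "sinh D > 0" by simp
  have len: "length Z = Suc N" and sub: "\<And>j. j \<le> N \<Longrightarrow> Z ! j \<in> hyp_plane"
    using Z by (auto simp: ngon_def subset_iff)
  define z where "z j = npoint_vec (Z ! j)" for j
  have z: "z j \<in> hyperboloid" "proj (z j) = Z ! j" if "j \<le> N" for j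
    using npoint_vec_hyperboloid[OF sub[OF that]] by (auto simp: z_def)
  have zz: "lform (z i) (z j) = cosh (t j - t i)" if "i \<le> j" "j \<le> N" for i j
    using degenerate_hyp_dist[OF Z(1) _ that] eq cosh_hyp_dist_proj(1)[OF z(1) z(1), of i j] z(2) that
    by (simp add: Z(2) t_def)
  have t0: "t 0 = 0" by (simp add: t_def)
  define a where "a = z 0"
  define b where "b = (1 / sinh D) *\<^sub>R (z N - cosh D *\<^sub>R z 0)"
  have zN: "lform (z 0) (z 0) = 1" "lform (z N) (z N) = 1" "lform (z 0) (z N) = cosh D" "lform (z N) (z 0) = cosh D"
    using zz[of 0 0] zz[of N N] zz[of 0 N] by (auto simp: t0 D_def lform_commute)
  have "lform b b = (1 - (cosh D)\<^sup>2) / (sinh D)\<^sup>2"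
    by (simp add: b_def lform_bilinear zN power2_eq_square)
  then have bb: "lform b b = - 1" using sD by (simp add: cosh_square_eq)
  have ab: "lform a b = 0" by (simp add: a_def b_def lform_bilinear zN)
  have aa: "a \<in> hyperboloid" "lform a a = 1" using z(1)[of 0] zN by (simp_all add: a_def)
  have o: "lform a (lcross a b) = 0" "lform b (lcross a b) = 0" "lform (lcross a b) (lcross a b) = - 1"
    using aa ab bb lform_lcross[of a b a] lform_lcross[of a b b]
    by (simp_all add: lform_lcross_lcross lform_commute[of a "lcross a b"]
      lform_commute[of b "lcross a b"] det3_expand)
  define A where "A = cols3 a b (lcross a b)"
  have A: "lorentz A" unfolding A_def using aa ab bb o by (intro lorentz_cols3) auto
  have Az: "A *v axis_point (t j) = z j" if j: "j \<le> N" for j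
  proof -
    have "lform (z j) a = cosh (t j)"
      using zz[of 0 j] j t0 by (simp add: a_def lform_commute)
    moreover have "lform (z j) b = (cosh (D - t j) - cosh D * cosh (t j)) / sinh D"
      using zz[of 0 j] zz[of j N] j t0 by (simp add: b_def lform_bilinear lform_commute[of "z j" "z 0"] D_def)
    then have "lform (z j) b = - sinh (t j)" using sD by (simp add: cosh_diff)
    ultimately have "lform (z j) (A *v axis_point (t j)) = (cosh (t j))\<^sup>2 - (sinh (t j))\<^sup>2"
      by (simp add: A_def cols3_mult lform_bilinear power2_eq_square)
    then have "lform (z j) (A *v axis_point (t j)) = 1" by (simp add: cosh_square_eq)
    then show ?thesis
      using lform_hyperboloid_eq_1_iff[OF z(1)[OF j] lorentz_hyperboloid[OF A axis_point_hyperboloid]] by simp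
  qed
  have "Z = map (lorentz_map A) (line_polygon L)"
    by (rule nth_equalityI)
      (simp_all add: len line_polygon_def L lorentz_map_proj axis_point_hyperboloid z Az[unfolded t_def] del: upt_Suc)
  with A that show thesis by blast
qed

lemma proj_in_open_segment:
  assumes "p $ 1 > 0" "q $ 1 > 0" "proj p \<noteq> proj q" "a > 0" "b > 0"
  shows "proj (a *\<^sub>R p + b *\<^sub>R q) \<in> open_segment (proj p) (proj q)"
proof -
  define m where "m = a * p $ 1 + b * q $ 1"
  have m: "a * p $ 1 > 0" "b * q $ 1 > 0" "m > 0" using assms by (simp_all add: m_def add_pos_pos)
  define u where "u = b * q $ 1 / m"
  have u: "0 < u" "u < 1" using m by (simp_all add: u_def m_def)
  have u1: "1 - u = a * p $ 1 / m" using m by (simp add: u_def m_def field_simps)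
  have "proj (a *\<^sub>R p + b *\<^sub>R q) = (1 - u) *\<^sub>R proj p + u *\<^sub>R proj q"
    unfolding u1 unfolding u_def using assms(1,2)
    by (simp add: vec_eq_iff forall_2 add_divide_distrib flip: m_def)
  then show ?thesis using u assms(3) by (auto simp: in_segment)
qed

text \<open>The endpoints of the chord are the images of the null vectors \<open>(1, -1, 0)\<close> and
  \<open>(1, 1, 0)\<close>, since \<open>axis_point t\<close> is a positive combination of them.\<close>

lemma hyp_line_lorentz_map_axis_point:
  assumes A: "lorentz A"
  shows "\<exists>l. hyp_line l \<and> (\<forall>t. proj (A *v axis_point t) \<in> l)"
proof -
  obtain B where B: "lorentz B" "B ** A = mat 1" "A ** B = mat 1" using lorentz_inverse[OF A] by blast
  define n where "n e = (vector [1, e, 0] :: real^3)" for e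
  have n: "n e $ 1 = 1" "n e $ 2 = e" "n e $ 3 = 0" for e by (simp_all add: n_def vector_3)
  have one: "axis 1 1 \<in> hyperboloid" by (simp add: hyperboloid_def axis_def lform_def)
  have pos: "(A *v n e) $ 1 > 0" if e: "\<bar>e\<bar> = 1" for e
  proof -
    define y where "y = B *v axis 1 1"
    have y: "y \<in> hyperboloid" "A *v y = axis 1 1"
      using lorentz_hyperboloid[OF B(1) one] B by (simp_all add: y_def matrix_vector_mul_assoc)
    \<comment> \<open>The first coordinate is the product with \<open>(1, 0, 0)\<close>, which is the image of \<open>y\<close>.\<close>
    have "(A *v n e) $ 1 = lform (A *v n e) (A *v y)" unfolding y(2) by (simp add: lform_def axis_def)
    also have "\<dots> = y $ 1 - e * y $ 2" by (simp add: lorentz_lform[OF A]) (simp add: lform_def n)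
    also have "\<dots> > 0"
    proof -
      have "(y $ 2)\<^sup>2 < (y $ 1)\<^sup>2" using y(1) zero_le_square[of "y $ 3"]
        unfolding hyperboloid_def lform_def power2_eq_square mem_Collect_eq by linarith
      then have "\<bar>y $ 2\<bar> < y $ 1" using y(1) power2_less_imp_less[of "\<bar>y $ 2\<bar>" "y $ 1"]
        by (simp add: hyperboloid_def)
      moreover have "e * y $ 2 \<le> \<bar>y $ 2\<bar>" using e abs_ge_self[of "e * y $ 2"] by (simp add: abs_mult)
      ultimately show ?thesis by linarith
    qed
    finally show ?thesis .
  qed
  have light: "lform (A *v n e) (A *v n e) = 0" if e: "\<bar>e\<bar> = 1" for e
  proof -
    have "e * e = 1" using e by (metis abs_mult_self_eq mult_1)
    then show ?thesis by (simp add: lorentz_lform[OF A]) (simp add: lform_def n)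
  qed
  have nrm: "norm (proj (A *v n e)) = 1" if e: "\<bar>e\<bar> = 1" for e
  proof -
    define x where "x = A *v n e"
    have "(x $ 2)\<^sup>2 + (x $ 3)\<^sup>2 = (x $ 1)\<^sup>2"
      using light[OF e] by (simp add: x_def lform_def power2_eq_square)
    then have "(x $ 2 / x $ 1)\<^sup>2 + (x $ 3 / x $ 1)\<^sup>2 = 1"
      using pos[OF e] by (simp add: x_def power_divide flip: add_divide_distrib)
    then show ?thesis by (simp add: norm_vec_def L2_set_def sum_2 x_def)
  qed
  define p q where "p = A *v n (-1)" "q = A *v n 1"
  note pq = this
  have ne: "proj p \<noteq> proj q"
  proof
    assume h: "proj p = proj q"
    have p0: "p $ 1 > 0" "q $ 1 > 0" using pos[of 1] pos[of "-1"] by (simp_all add: pq)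
    then have "p = (p $ 1 / q $ 1) *\<^sub>R q"
      using h by (simp add: vec_eq_iff forall_2 forall_3 field_simps)
    then have "lform p q = (p $ 1 / q $ 1) * lform q q" by (metis lform_scaleR_left)
    also have "\<dots> = 0" using light[of 1] by (simp add: pq)
    finally show False by (simp add: pq lorentz_lform[OF A]) (simp add: lform_def n)
  qed
  have "axis_point t = (exp (- t) / 2) *\<^sub>R n (-1) + (exp t / 2) *\<^sub>R n 1" for t
    by (simp add: vec_eq_iff forall_3 n cosh_def sinh_def field_simps)
  then have "proj (A *v axis_point t) = proj ((exp (- t) / 2) *\<^sub>R p + (exp t / 2) *\<^sub>R q)" for t
    by (simp add: pq matrix_vector_right_distrib matrix_vector_mult_scaleR)
  then have "proj (A *v axis_point t) \<in> open_segment (proj p) (proj q)" for t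
    using proj_in_open_segment[OF _ _ ne] pos[of 1] pos[of "-1"] by (simp add: pq)
  moreover have "hyp_line (open_segment (proj p) (proj q))"
    using ne nrm[of 1] nrm[of "-1"] unfolding hyp_line_def by (auto simp: pq)
  ultimately show ?thesis by blast
qed

text \<open>Null representatives of \<open>P\<close> and \<open>Q\<close> reduce the distance formula to
  \<open>(a d / (b c) + b c / (a d)) / 2\<close> with \<open>a\<^sup>2 = u\<close>, \<open>b\<^sup>2 = 1 - u\<close>, \<open>c\<^sup>2 = v\<close>, \<open>d\<^sup>2 = 1 - v\<close>; this is the
  hyperbolic cosine of a difference of logarithms.\<close>

lemma hyp_dist_chord:
  assumes PQ: "P \<noteq> Q" "norm P = 1" "norm Q = 1" and u: "0 < u" "u < 1" and v: "0 < v" "v < 1"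
  shows "hyp_dist ((1 - u) *\<^sub>R P + u *\<^sub>R Q) ((1 - v) *\<^sub>R P + v *\<^sub>R Q) =
    \<bar>ln (u / (1 - u)) / 2 - ln (v / (1 - v)) / 2\<bar>"
proof -
  define X where "X u = (1 - u) *\<^sub>R P + u *\<^sub>R Q" for u
  define p q where "p = point_vec P" "q = point_vec Q"
  note pq = this
  have n: "(P $ 1)\<^sup>2 + (P $ 2)\<^sup>2 = 1" "(Q $ 1)\<^sup>2 + (Q $ 2)\<^sup>2 = 1"
    using PQ(2,3) by (simp_all add: norm_vec_def L2_set_def sum_2)
  have p0: "lform p p = 0" "lform q q = 0" using n by (simp_all add: pq lform_def power2_eq_square)
  define r where "r = lform p q"
  have "2 * r = (P $ 1 - Q $ 1)\<^sup>2 + (P $ 2 - Q $ 2)\<^sup>2"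
    using n by (simp add: r_def pq lform_def power2_eq_square algebra_simps)
  moreover have "P $ 1 - Q $ 1 \<noteq> 0 \<or> P $ 2 - Q $ 2 \<noteq> 0" using PQ(1) by (auto simp: vec_eq_iff forall_2)
  ultimately have r: "r > 0" by (smt (verit) zero_less_power2 zero_le_power2)
  have X: "point_vec (X u) = (1 - u) *\<^sub>R p + u *\<^sub>R q" for u
    by (simp add: vec_eq_iff forall_3 X_def pq algebra_simps)
  have l: "lform (point_vec (X u)) (point_vec (X v)) = r * ((1 - u) * v + u * (1 - v))" for u v
    using p0 by (simp add: X lform_bilinear lform_commute[of q p] flip: r_def) (simp add: algebra_simps)
  define f where "f u = sqrt (u / (1 - u))" for u :: real
  have ln: "ln (u / (1 - u)) / 2 = ln (f u)" if "0 < u" "u < 1" for u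
    using that by (simp add: f_def ln_sqrt)
  have nm: "lnorm (point_vec (X u)) = sqrt (2 * r) * (sqrt u * sqrt (1 - u))" if "0 < u" "u < 1" for u
    using that r by (simp add: lnorm_def l abs_mult real_sqrt_mult[symmetric] algebra_simps)
  define a b c d where "a = sqrt u" "b = sqrt (1 - u)" "c = sqrt v" "d = sqrt (1 - v)"
  note abcd = this
  have pos: "a > 0" "b > 0" "c > 0" "d > 0" using u v by (auto simp: abcd)
  have sq: "u = a\<^sup>2" "1 - u = b\<^sup>2" "v = c\<^sup>2" "1 - v = d\<^sup>2" using u v by (simp_all add: abcd)
  have f: "f u = a / b" "f v = c / d" by (simp_all add: f_def abcd real_sqrt_divide)
  have "cosh (ln (f u) - ln (f v)) = cosh (ln (a * d / (b * c)))"
    using pos by (simp add: f ln_div ln_mult)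
  also have "\<dots> = (a * d / (b * c) + b * c / (a * d)) / 2"
    using pos by (subst cosh_ln_real) auto
  also have "\<dots> = (b\<^sup>2 * c\<^sup>2 + a\<^sup>2 * d\<^sup>2) / (2 * (a * b) * (c * d))"
    using pos by (simp add: field_simps power2_eq_square)
  also have "\<dots> = lform (point_vec (X u)) (point_vec (X v)) / (lnorm (point_vec (X u)) * lnorm (point_vec (X v)))"
  proof -
    have "lnorm (point_vec (X u)) * lnorm (point_vec (X v)) = (sqrt (2 * r))\<^sup>2 * ((a * b) * (c * d))"
      using nm u v by (simp add: power2_eq_square abcd del: real_sqrt_pow2_iff)
    also have "\<dots> = r * (2 * (a * b) * (c * d))" using r by simp
    finally show ?thesis using r unfolding l by (simp flip: sq)
  qed
  finally have "hyp_dist (X u) (X v) = arcosh (cosh \<bar>ln (f u) - ln (f v)\<bar>)" by (simp add: hyp_dist_def)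
  also have "\<dots> = \<bar>ln (f u) - ln (f v)\<bar>" by (rule arcosh_cosh_real) simp
  finally show ?thesis using ln u v by (simp add: X_def)
qed

text \<open>The first and the last value already have the maximal distance, so the sign of their
  difference decides the direction for all values in between.\<close>

lemma isometric_sequence_monotone:
  fixes r t :: "nat \<Rightarrow> real"
  assumes "\<And>i j. i \<le> j \<Longrightarrow> j \<le> N \<Longrightarrow> \<bar>r j - r i\<bar> = t j - t i"
  shows "(\<forall>j\<le>N. r j = r 0 + (t j - t 0)) \<or> (\<forall>j\<le>N. r j = r 0 - (t j - t 0))"
proof -
  have 1: "\<bar>r N - r 0\<bar> = t N - t 0" using assms by simp
  have 2: "\<bar>r j - r 0\<bar> = t j - t 0" "\<bar>r N - r j\<bar> = t N - t j" if "j \<le> N" for j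
    using assms that by simp_all
  show ?thesis
  proof (cases "r N \<ge> r 0")
    case True
    then have "r j = r 0 + (t j - t 0)" if "j \<le> N" for j using 1 2[OF that] by linarith
    then show ?thesis by blast
  next
    case False
    then have "r j = r 0 - (t j - t 0)" if "j \<le> N" for j using 1 2[OF that] by linarith
    then show ?thesis by blast
  qed
qed

lemma degenerate_monotone:
  assumes L: "length L = Suc N" "\<And>i. i \<le> N \<Longrightarrow> L ! i > 0"
    and eq: "L ! N = (\<Sum>i<N. L ! i)" and Z: "ngon (Suc N) Z" "sidelengths Z = L"
    and l: "hyp_line l" "set Z \<subseteq> l"
  shows "strictly_monotone_along l Z"
proof -
  have len: "length Z = Suc N" using Z by (simp add: ngon_def)
  obtain P Q where PQ: "P \<noteq> Q" "norm P = 1" "norm Q = 1" "l = open_segment P Q"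
    using l(1) by (auto simp: hyp_line_def)
  have "\<exists>u. 0 < u \<and> u < 1 \<and> Z ! j = (1 - u) *\<^sub>R P + u *\<^sub>R Q" if "j \<le> N" for j
  proof -
    have "Z ! j \<in> open_segment P Q" using l(2) PQ(4) len that by (auto simp: subset_iff)
    then show ?thesis by (auto simp: in_segment)
  qed
  then obtain u where u: "0 < u j" "u j < 1" "Z ! j = (1 - u j) *\<^sub>R P + u j *\<^sub>R Q" if "j \<le> N" for j
    by metis
  define r where "r j = ln (u j / (1 - u j)) / 2" for j
  define t where "t j = (\<Sum>i<j. L ! i)" for j
  have t: "t i < t j" if "i < j" "j \<le> N" for i j
    unfolding t_def using that L(2) by (intro sum_strict_mono2[of _ _ i]) (auto intro: less_imp_le)
  have "\<bar>r j - r i\<bar> = t j - t i" if ij: "i \<le> j" "j \<le> N" for i j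
  proof -
    have "hyp_dist (Z ! i) (Z ! j) = t j - t i"
      using degenerate_hyp_dist[OF Z(1) _ ij] eq by (simp add: Z(2) t_def)
    then show ?thesis using hyp_dist_chord[OF PQ(1-3) u(1,2) u(1,2), of i j] u(3) ij by (simp add: r_def)
  qed
  then have r: "(\<forall>j\<le>N. r j = r 0 + (t j - t 0)) \<or> (\<forall>j\<le>N. r j = r 0 - (t j - t 0))"
    by (rule isometric_sequence_monotone)
  have ur: "r i < r j \<longleftrightarrow> u i < u j" if "i \<le> N" "j \<le> N" for i j
  proof -
    have "r i < r j \<longleftrightarrow> u i / (1 - u i) < u j / (1 - u j)"
      using u that by (simp add: r_def)
    also have "\<dots> \<longleftrightarrow> u i < u j" using u[OF that(1)] u[OF that(2)] by (simp add: divide_simps algebra_simps)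
    finally show ?thesis .
  qed
  have strict: "strictly_monotone_along l Z"
    if P'Q': "P' \<noteq> Q'" "norm P' = 1" "norm Q' = 1" "l = open_segment P' Q'"
      and w: "\<And>j. j \<le> N \<Longrightarrow> 0 < w j \<and> w j < 1 \<and> Z ! j = (1 - w j) *\<^sub>R P' + w j *\<^sub>R Q'"
      and inc: "\<And>i j. i < j \<Longrightarrow> j \<le> N \<Longrightarrow> w i < w j" for P' Q' w
  proof -
    have "sorted_wrt (<) (map w [0..<Suc N])"
      using inc by (auto simp: sorted_wrt_iff_nth_less simp del: upt_Suc)
    moreover have "set (map w [0..<Suc N]) \<subseteq> {0<..<1}" using w by (auto simp del: upt_Suc)
    moreover have "Z = map (\<lambda>t. (1 - t) *\<^sub>R P' + t *\<^sub>R Q') (map w [0..<Suc N])"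
      by (rule nth_equalityI) (use w in \<open>simp_all add: len del: upt_Suc\<close>)
    ultimately show ?thesis using P'Q' unfolding strictly_monotone_along_def by blast
  qed
  from r show ?thesis
  proof
    assume h: "\<forall>j\<le>N. r j = r 0 + (t j - t 0)"
    have "u i < u j" if "i < j" "j \<le> N" for i j
    proof -
      have "r i < r j" using h[rule_format, of i] h[rule_format, of j] t that by simp
      then show ?thesis using ur[of i j] that by simp
    qed
    then show ?thesis using strict[of P Q u] PQ u by blast
  next
    assume h: "\<forall>j\<le>N. r j = r 0 - (t j - t 0)"
    have "u j < u i" if "i < j" "j \<le> N" for i j
    proof -
      have "r j < r i" using h[rule_format, of i] h[rule_format, of j] t that by simp
      then show ?thesis using ur[of j i] that by simp
    qed
    then show ?thesis using strict[of Q P "\<lambda>j. 1 - u j"] PQ u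
      by (simp add: open_segment_commute add.commute)
  qed
qed

lemma degenerate_polygon_max_last:
  assumes N: "N \<ge> 2" and L: "length L = Suc N" "\<And>i. i \<le> N \<Longrightarrow> L ! i > 0"
    and eq: "L ! N = (\<Sum>i<N. L ! i)"
  shows "\<exists>Z. ngon (Suc N) Z \<and> sidelengths Z = L"
    and "ngon (Suc N) Z \<Longrightarrow> sidelengths Z = L \<Longrightarrow> ngon (Suc N) W \<Longrightarrow> sidelengths W = L \<Longrightarrow> hyp_congruent Z W"
    and "ngon (Suc N) Z \<Longrightarrow> sidelengths Z = L \<Longrightarrow> collinear_polygon Z"
    and "ngon (Suc N) Z \<Longrightarrow> sidelengths Z = L \<Longrightarrow> hyp_line l \<Longrightarrow> set Z \<subseteq> l \<Longrightarrow> strictly_monotone_along l Z"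
    and "ngon (Suc N) Z \<Longrightarrow> sidelengths Z = L \<Longrightarrow> distinct Z"
proof -
  show "\<exists>Z. ngon (Suc N) Z \<and> sidelengths Z = L" using line_polygon_properties[OF N L eq] by blast
  have sub: "set (line_polygon L) \<subseteq> hyp_plane"
    by (auto simp: line_polygon_def intro!: proj_hyperboloid axis_point_hyperboloid)
  show "hyp_congruent Z W" if "ngon (Suc N) Z" "sidelengths Z = L" "ngon (Suc N) W" "sidelengths W = L"
    using degenerate_normal_form[OF N L eq that(1,2)] degenerate_normal_form[OF N L eq that(3,4)]
      hyp_congruent_lorentz_map[OF _ _ sub] by metis
  show mono: "strictly_monotone_along l Z" if "ngon (Suc N) Z" "sidelengths Z = L" "hyp_line l" "set Z \<subseteq> l" for l
    using degenerate_monotone[OF L eq that] .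
  show col: "collinear_polygon Z" if "ngon (Suc N) Z" "sidelengths Z = L"
  proof -
    obtain A where A: "lorentz A" "Z = map (lorentz_map A) (line_polygon L)"
      using degenerate_normal_form[OF N L eq \<open>ngon (Suc N) Z\<close> \<open>sidelengths Z = L\<close>] by blast
    obtain l where "hyp_line l" "\<And>t. proj (A *v axis_point t) \<in> l" using hyp_line_lorentz_map_axis_point[OF A(1)] by blast
    then show ?thesis unfolding collinear_polygon_def A(2)
      by (intro exI[of _ l]) (auto simp: line_polygon_def lorentz_map_proj axis_point_hyperboloid)
  qed
  show "distinct Z" if Z: "ngon (Suc N) Z" "sidelengths Z = L"
  proof -
    obtain l where "hyp_line l" "set Z \<subseteq> l" using col[OF Z] by (auto simp: collinear_polygon_def)
    then obtain P Q ts where ts: "P \<noteq> Q" "sorted_wrt (<) ts" "Z = map (\<lambda>t. (1 - t) *\<^sub>R P + t *\<^sub>R Q) ts"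
      using mono[OF Z] unfolding strictly_monotone_along_def by blast
    have "inj (\<lambda>t. (1 - t) *\<^sub>R P + t *\<^sub>R Q)"
    proof (rule injI)
      fix s t assume "(1 - s) *\<^sub>R P + s *\<^sub>R Q = (1 - t) *\<^sub>R P + t *\<^sub>R Q"
      then have "(s - t) *\<^sub>R (Q - P) = 0" by (simp add: algebra_simps)
      then show "s = t" using ts(1) by simp
    qed
    then show ?thesis using ts strict_sorted_iff
      by (auto simp: distinct_map intro: inj_on_subset)
  qed
qed

section \<open>Change of the first vertex\<close>

lemma Suc_mod_inj: "i < n \<Longrightarrow> j < n \<Longrightarrow> Suc i mod n = Suc j mod n \<longleftrightarrow> i = j"
  by (auto simp: mod_Suc split: if_splits)

lemma sidelengths_rotate1: "sidelengths (rotate1 Z) = rotate1 (sidelengths Z)"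
proof (rule nth_equalityI)
  fix i assume "i < length (sidelengths (rotate1 Z))"
  then have i: "i < length Z" "Suc i mod length Z < length Z"
    by (auto simp: length_sidelengths intro!: mod_less_divisor)
  then show "sidelengths (rotate1 Z) ! i = rotate1 (sidelengths Z) ! i"
    by (simp add: length_sidelengths sidelengths_nth nth_rotate1)
qed (simp add: length_sidelengths)

lemma ngon_rotate1: "ngon n Z \<Longrightarrow> ngon n (rotate1 Z)"
  by (auto simp: ngon_def nth_rotate1)

lemma oriented_convex_rotate1:
  assumes "oriented_convex Z"
  shows "oriented_convex (rotate1 Z)"
  unfolding oriented_convex_def length_rotate1
proof (intro allI impI)
  fix k j assume h: "k < length Z" "j < length Z" "j \<noteq> k \<and> j \<noteq> Suc k mod length Z"
  define n where "n = length Z"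
  have n: "k < n" "j < n" "n > 0" using h by (auto simp: n_def)
  have lt: "Suc k mod n < n" "Suc j mod n < n" using n by simp_all
  have "Suc j mod n \<noteq> Suc k mod n" "Suc j mod n \<noteq> Suc (Suc k mod n) mod n"
    using h n lt Suc_mod_inj[of j n k] Suc_mod_inj[of j n "Suc k mod n"] by (auto simp: n_def)
  then show "det3 (point_vec (rotate1 Z ! k)) (point_vec (rotate1 Z ! (Suc k mod length Z))) (point_vec (rotate1 Z ! j)) > 0"
    using assms lt n unfolding oriented_convex_def n_def[symmetric]
    by (simp add: nth_rotate1 flip: n_def)
qed

lemma sidelengths_rotate: "sidelengths (rotate m Z) = rotate m (sidelengths Z)"
  and ngon_rotate: "ngon n Z \<Longrightarrow> ngon n (rotate m Z)"
  and oriented_convex_rotate: "oriented_convex Z \<Longrightarrow> oriented_convex (rotate m Z)"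
  by (induction m) (simp_all add: sidelengths_rotate1 ngon_rotate1 oriented_convex_rotate1)

lemma cocyclic_rotate: "cocyclic_polygon (rotate m Z) \<longleftrightarrow> cocyclic_polygon Z"
  and collinear_rotate: "collinear_polygon (rotate m Z) \<longleftrightarrow> collinear_polygon Z"
  by (simp_all add: cocyclic_polygon_def collinear_polygon_def)

lemma rotate_cancel: "m \<le> length xs \<Longrightarrow> rotate (length xs - m) (rotate m xs) = xs"
  by (simp add: rotate_rotate)

lemma rotate_inject: "rotate m xs = rotate m ys \<longleftrightarrow> xs = ys"
  by (induction m) (auto simp: inj_eq[OF inj_rotate1])

lemma hyp_equivalent_rotate: "hyp_equivalent (rotate m Z) (rotate m W) \<longleftrightarrow> hyp_equivalent Z W"
  and hyp_congruent_rotate: "hyp_congruent (rotate m Z) (rotate m W) \<longleftrightarrow> hyp_congruent Z W"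
  by (simp_all add: hyp_equivalent_def hyp_congruent_def rotate_inject flip: rotate_map)

lemma sum_except:
  fixes f :: "nat \<Rightarrow> real"
  assumes "k < n"
  shows "(\<Sum>j\<in>{..<n} - {k}. f j) = (\<Sum>j<n. f j) - f k"
  using assms by (simp add: sum_diff1)

lemma sum_nth_rotate:
  fixes L :: "real list"
  shows "(\<Sum>i<length L. rotate m L ! i) = (\<Sum>i<length L. L ! i)"
proof -
  have "sum_list (rotate1 xs) = sum_list xs" for xs :: "real list" by (cases xs) auto
  then have "sum_list (rotate m L) = sum_list L" by (induction m) auto
  then show ?thesis by (simp add: sum_list_sum_nth atLeast0LessThan)
qed

theorem theorem5p3:
  fixes n :: nat and L :: "real list"
  assumes "n \<ge> 3" and "length L = n"
    and "\<forall>k<n. L ! k > 0"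
    and "\<forall>k<n. L ! k \<le> (\<Sum>j\<in>{..<n} - {k}. L ! j)"
  shows
    "((\<forall>k<n. L ! k < (\<Sum>j\<in>{..<n} - {k}. L ! j)) \<longrightarrow>
        (\<exists>Z. ngon n Z \<and> oriented_convex Z \<and> cocyclic_polygon Z \<and> sidelengths Z = L) \<and>
        (\<forall>Z W. ngon n Z \<and> oriented_convex Z \<and> cocyclic_polygon Z \<and> sidelengths Z = L \<and>
               ngon n W \<and> oriented_convex W \<and> cocyclic_polygon W \<and> sidelengths W = L \<longrightarrow>
               hyp_equivalent Z W)) \<and>
     (\<forall>m<n. L ! m = (\<Sum>j\<in>{..<n} - {m}. L ! j) \<longrightarrow>
        (\<exists>Z. ngon n Z \<and> sidelengths Z = L) \<and>
        (\<forall>Z W. ngon n Z \<and> sidelengths Z = L \<and> ngon n W \<and> sidelengths W = L \<longrightarrow>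
               hyp_congruent Z W) \<and>
        (\<forall>Z. ngon n Z \<and> sidelengths Z = L \<longrightarrow>
             collinear_polygon Z \<and>
             (\<forall>l. hyp_line l \<and> set Z \<subseteq> l \<longrightarrow>
                  strictly_monotone_along l (rotate (Suc m) Z)) \<and>
             distinct Z))"
proof -
  obtain N where N: "n = Suc N" "N \<ge> 2" using assms(1) by (cases n) auto
  \<comment> \<open>After this rotation the side \<open>m\<close> is the last one.\<close>
  have rot: "length (rotate (Suc m) L) = Suc N" "\<And>i. i \<le> N \<Longrightarrow> rotate (Suc m) L ! i > 0"
      "rotate (Suc m) L ! N = L ! m"
      "(\<Sum>i<N. rotate (Suc m) L ! i) = (\<Sum>j\<in>{..<n} - {m}. L ! j)" if m: "m < n" for m
  proof -
    show "length (rotate (Suc m) L) = Suc N" using assms(2) N by simp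
    show "rotate (Suc m) L ! i > 0" if "i \<le> N" for i
      using that assms(2,3) N by (simp add: nth_rotate del: rotate_Suc)
    have "(Suc m + N) mod Suc N = (m + Suc N) mod Suc N" by simp
    also have "\<dots> = m" using m N by (simp only: mod_add_self2 mod_less)
    finally show last: "rotate (Suc m) L ! N = L ! m"
      using assms(2) N m by (simp add: nth_rotate del: rotate_Suc add_Suc add_Suc_right)
    show "(\<Sum>i<N. rotate (Suc m) L ! i) = (\<Sum>j\<in>{..<n} - {m}. L ! j)"
      using sum_nth_rotate[of "Suc m" L] sum_except[OF m, of "(!) L"] assms(2) N last
      by (simp del: rotate_Suc)
  qed
  have rotate_back: "rotate (n - Suc m) (rotate (Suc m) L) = L" if "m < n" for m
    using rotate_cancel[of "Suc m" L] that assms(2) by (simp del: rotate_Suc)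
  have strict: "(\<exists>Z. ngon n Z \<and> oriented_convex Z \<and> cocyclic_polygon Z \<and> sidelengths Z = L) \<and>
        (\<forall>Z W. ngon n Z \<and> oriented_convex Z \<and> cocyclic_polygon Z \<and> sidelengths Z = L \<and>
               ngon n W \<and> oriented_convex W \<and> cocyclic_polygon W \<and> sidelengths W = L \<longrightarrow>
               hyp_equivalent Z W)" if less: "\<forall>k<n. L ! k < (\<Sum>j\<in>{..<n} - {k}. L ! j)"
  proof -
    obtain m where m: "m < n" "\<And>j. j < n \<Longrightarrow> L ! j \<le> L ! m"
    proof -
      have "Max (set L) \<in> set L" using assms(1,2) by (intro Max_in) auto
      then obtain m where "m < n" "L ! m = Max (set L)" using assms(2) by (auto simp: in_set_conv_nth)
      then show thesis using that[of m] assms(2) by simp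
    qed
    let ?L = "rotate (Suc m) L"
    have max: "?L ! i \<le> ?L ! N" if "i < N" for i
      unfolding rot(3)[OF m(1)] using that N assms(2) m(2) by (simp add: nth_rotate del: rotate_Suc)
    have lt: "?L ! N < (\<Sum>i<N. ?L ! i)" using rot(3,4)[OF m(1)] less m(1) by (simp del: rotate_Suc)
    note P = convex_cocyclic_polygon_max_last[OF N(2) rot(1,2)[OF m(1)] max lt, folded N(1)]
    have "\<exists>Z. ngon n Z \<and> oriented_convex Z \<and> cocyclic_polygon Z \<and> sidelengths Z = L"
    proof -
      obtain Z where "ngon n Z" "oriented_convex Z" "cocyclic_polygon Z" "sidelengths Z = ?L"
        using P(1) by blast
      then show ?thesis using rotate_back[OF m(1)]
        by (intro exI[of _ "rotate (n - Suc m) Z"])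
          (simp add: ngon_rotate oriented_convex_rotate cocyclic_rotate sidelengths_rotate del: rotate_Suc)
    qed
    moreover have "hyp_equivalent Z W"
      if "ngon n Z" "oriented_convex Z" "cocyclic_polygon Z" "sidelengths Z = L"
        "ngon n W" "oriented_convex W" "cocyclic_polygon W" "sidelengths W = L" for Z W
      using P(2)[of "rotate (Suc m) Z" "rotate (Suc m) W"] that
      by (simp add: ngon_rotate oriented_convex_rotate cocyclic_rotate sidelengths_rotate
          hyp_equivalent_rotate del: rotate_Suc)
    ultimately show ?thesis by blast
  qed
  have degenerate: "(\<exists>Z. ngon n Z \<and> sidelengths Z = L) \<and>
        (\<forall>Z W. ngon n Z \<and> sidelengths Z = L \<and> ngon n W \<and> sidelengths W = L \<longrightarrow>
               hyp_congruent Z W) \<and>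
        (\<forall>Z. ngon n Z \<and> sidelengths Z = L \<longrightarrow>
             collinear_polygon Z \<and>
             (\<forall>l. hyp_line l \<and> set Z \<subseteq> l \<longrightarrow>
                  strictly_monotone_along l (rotate (Suc m) Z)) \<and>
             distinct Z)" if m: "m < n" and eq: "L ! m = (\<Sum>j\<in>{..<n} - {m}. L ! j)" for m
  proof -
    let ?L = "rotate (Suc m) L"
    have "?L ! N = (\<Sum>i<N. ?L ! i)" using rot(3,4)[OF m] eq by (simp del: rotate_Suc)
    note P = degenerate_polygon_max_last[OF N(2) rot(1,2)[OF m] this, folded N(1)]
    have "\<exists>Z. ngon n Z \<and> sidelengths Z = L"
    proof -
      obtain Z where "ngon n Z" "sidelengths Z = ?L" using P(1) by blast
      then show ?thesis using rotate_back[OF m]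
        by (intro exI[of _ "rotate (n - Suc m) Z"]) (simp add: ngon_rotate sidelengths_rotate del: rotate_Suc)
    qed
    moreover have "hyp_congruent Z W"
      if "ngon n Z" "sidelengths Z = L" "ngon n W" "sidelengths W = L" for Z W
      using P(2)[of "rotate (Suc m) Z" "rotate (Suc m) W"] that
      by (simp add: ngon_rotate sidelengths_rotate hyp_congruent_rotate del: rotate_Suc)
    moreover have "collinear_polygon Z \<and> (\<forall>l. hyp_line l \<and> set Z \<subseteq> l \<longrightarrow>
                  strictly_monotone_along l (rotate (Suc m) Z)) \<and> distinct Z"
      if "ngon n Z" "sidelengths Z = L" for Z
      using P(3-5)[of "rotate (Suc m) Z"] that
      by (simp add: ngon_rotate sidelengths_rotate collinear_rotate del: rotate_Suc)
    ultimately show ?thesis by blast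
  qed
  show ?thesis using strict degenerate by blast
qed


end
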